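(* Let $G$ and $H$ be finite abstract simplicial complexes and $k\ge1$, $p\ge0$. Then $$H^p_k(G\times H)\cong\bigoplus_{i+j=p}H^i_k(G)\otimes H^j_k(H).$$
   Context: A finite abstract simplicial complex is a finite set of nonempty finite sets closed under taking nonempty subsets; $\dim(x)=|x|-1$. Fix an orientation of every simplex; for oriented $x=(v_0,\dots,v_m)$, $m\ge1$, $\delta x=\sum_{i=0}^m(-1)^i(v_0,\dots,\hat v_i,\dots,v_m)$ (faces with opposite orientation counted with sign $-1$), $\delta x=0$ for $m=0$. The Cartesian product $G\times H$ is the set of cells $(x,y)$, $x\in G$, $y\in H$, of dimension $\dim x+\dim y$, with boundary $\delta(x,y)=(\delta x,y)+(-1)^{\dim x}(x,\delta y)$; two cells $(x,y),(u,v)$ intersect iff $x\cap u\ne\emptyset$ and $y\cap v\ne\emptyset$. For a complex (or product) $K$, an interacting $k$-tuple is a $k$-tuple of simplices (cells) of $K$ which pairwise intersect; its degree is the sum of their dimensions. $\Omega^p$ is the real vector space of functions on interacting $k$-tuples of degree $p$ (extended by zero to non-interacting tuples and multilinearly to chains); the exterior derivative is $(dF)(c_1,\dots,c_k)=\sum_{j=1}^k(-1)^{\sum_{i<j}\dim(c_i)}F(c_1,\dots,\delta c_j,\dots,c_k)$, $d\circ d=0$, and $H^p_k(K)=\ker(d|_{\Omega^p})/\mathrm{im}(d|_{\Omega^{p-1}})$. *)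

theory Defs
  imports "Jordan_Normal_Form.VS_Connect" "HOL-Algebra.AbelCoset" "HOL-Combinatorics.Permutations"
begin

section \<open>Quotients, direct sums and tensor products of modules\<close>

text \<open>
  The fields \<open>mult\<close> and \<open>one\<close> of a module record carry no information; as in
  \<^const>\<open>direct_sum\<close> they are filled with the zero element.
\<close>

definition quotient_module ::
    "('r, 'm, 'e) module_scheme \<Rightarrow> 'm set \<Rightarrow> ('r, 'm set) module" where
  "quotient_module M N =
     \<lparr>carrier = a_rcosets\<^bsub>M\<^esub> N,
      mult = (\<lambda>X Y. N),
      one = N,
      zero = N,
      add = (\<lambda>X Y. X <+>\<^bsub>M\<^esub> Y),
      smult = (\<lambda>r X. \<Union>x\<in>X. N +>\<^bsub>M\<^esub> (r \<odot>\<^bsub>M\<^esub> x))\<rparr>"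

definition direct_sum_family ::
    "'i set \<Rightarrow> ('i \<Rightarrow> ('r, 'm, 'e) module_scheme) \<Rightarrow> ('r, 'i \<Rightarrow> 'm) module" where
  "direct_sum_family I M =
     \<lparr>carrier = {x \<in> \<Pi>\<^sub>E i\<in>I. carrier (M i). finite {i \<in> I. x i \<noteq> \<zero>\<^bsub>M i\<^esub>}},
      mult = (\<lambda>x y. \<lambda>i\<in>I. \<zero>\<^bsub>M i\<^esub>),
      one = (\<lambda>i\<in>I. \<zero>\<^bsub>M i\<^esub>),
      zero = (\<lambda>i\<in>I. \<zero>\<^bsub>M i\<^esub>),
      add = (\<lambda>x y. \<lambda>i\<in>I. x i \<oplus>\<^bsub>M i\<^esub> y i),
      smult = (\<lambda>r x. \<lambda>i\<in>I. r \<odot>\<^bsub>M i\<^esub> x i)\<rparr>"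

definition free_module :: "('r, 'e) ring_scheme \<Rightarrow> 's set \<Rightarrow> ('r, 's \<Rightarrow> 'r) module" where
  "free_module R S =
     (ring.func_space R S)
       \<lparr>carrier := {f \<in> carrier (ring.func_space R S). finite {s \<in> S. f s \<noteq> \<zero>\<^bsub>R\<^esub>}}\<rparr>"

definition free_gen :: "('r, 'e) ring_scheme \<Rightarrow> 's set \<Rightarrow> 's \<Rightarrow> 's \<Rightarrow> 'r" where
  "free_gen R S s = (\<lambda>t\<in>S. if t = s then \<one>\<^bsub>R\<^esub> else \<zero>\<^bsub>R\<^esub>)"

definition tensor_relations ::
    "('r, 'e) ring_scheme \<Rightarrow> ('r, 'm, 'f) module_scheme \<Rightarrow> ('r, 'n, 'g) module_scheme
      \<Rightarrow> ('m \<times> 'n \<Rightarrow> 'r) set" where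
  "tensor_relations R M N =
     (let F = free_module R (carrier M \<times> carrier N);
          e = (\<lambda>x y. free_gen R (carrier M \<times> carrier N) (x, y))
      in {e (x \<oplus>\<^bsub>M\<^esub> x') y \<ominus>\<^bsub>F\<^esub> (e x y \<oplus>\<^bsub>F\<^esub> e x' y) | x x' y.
            x \<in> carrier M \<and> x' \<in> carrier M \<and> y \<in> carrier N}
       \<union> {e x (y \<oplus>\<^bsub>N\<^esub> y') \<ominus>\<^bsub>F\<^esub> (e x y \<oplus>\<^bsub>F\<^esub> e x y') | x y y'.
            x \<in> carrier M \<and> y \<in> carrier N \<and> y' \<in> carrier N}
       \<union> {e (r \<odot>\<^bsub>M\<^esub> x) y \<ominus>\<^bsub>F\<^esub> (r \<odot>\<^bsub>F\<^esub> e x y) | r x y.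
            r \<in> carrier R \<and> x \<in> carrier M \<and> y \<in> carrier N}
       \<union> {e x (r \<odot>\<^bsub>N\<^esub> y) \<ominus>\<^bsub>F\<^esub> (r \<odot>\<^bsub>F\<^esub> e x y) | r x y.
            r \<in> carrier R \<and> x \<in> carrier M \<and> y \<in> carrier N})"

definition tensor_product ::
    "('r, 'e) ring_scheme \<Rightarrow> ('r, 'm, 'f) module_scheme \<Rightarrow> ('r, 'n, 'g) module_scheme
      \<Rightarrow> ('r, ('m \<times> 'n \<Rightarrow> 'r) set) module" where
  "tensor_product R M N =
     quotient_module (free_module R (carrier M \<times> carrier N))
       (LinearCombinations.module.span R (free_module R (carrier M \<times> carrier N))
          (tensor_relations R M N))"

text \<open>\<^const>\<open>linear_map\<close> includes that both sides are vector spaces over \<open>K\<close>.\<close>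

definition vs_isomorphic ::
    "('r, 'e) ring_scheme \<Rightarrow> ('r, 'm, 'f) module_scheme \<Rightarrow> ('r, 'n, 'g) module_scheme \<Rightarrow> bool"
  where
  "vs_isomorphic K V W \<longleftrightarrow>
     (\<exists>T. linear_map K V W T \<and> bij_betw T (carrier V) (carrier W))"

section \<open>Simplicial complexes and their products\<close>

definition simplicial_complex :: "'v set set \<Rightarrow> bool" where
  "simplicial_complex G \<longleftrightarrow>
     finite G \<and>
     (\<forall>x\<in>G. finite x \<and> x \<noteq> {} \<and> (\<forall>y. y \<subseteq> x \<and> y \<noteq> {} \<longrightarrow> y \<in> G))"

text \<open>An orientation of a simplex is represented by an ordering of its vertices.\<close>

definition orientation :: "'v set set \<Rightarrow> ('v set \<Rightarrow> 'v list) \<Rightarrow> bool" where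
  "orientation G ori \<longleftrightarrow> (\<forall>x\<in>G. distinct (ori x) \<and> set (ori x) = x)"

text \<open>
  Chains are represented by their coefficient functions: \<open>boundary K c c'\<close> is the coefficient
  of the cell \<open>c'\<close> in the boundary of the cell \<open>c\<close>.
\<close>

record 'c cell_complex =
  cells :: "'c set"
  cell_dim :: "'c \<Rightarrow> nat"
  boundary :: "'c \<Rightarrow> 'c \<Rightarrow> real"
  meets :: "'c \<Rightarrow> 'c \<Rightarrow> bool"

text \<open>
  For two orderings of the same vertex set, \<open>rel_sign vs ws\<close> is \<open>1\<close> if they define the same
  orientation and \<open>-1\<close> otherwise.
\<close>

definition rel_sign :: "'v list \<Rightarrow> 'v list \<Rightarrow> real" where
  "rel_sign vs ws = real_of_int (sign (THE \<pi>. \<pi> permutes set vs \<and> map \<pi> vs = ws))"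

definition oriented_simplex :: "('v set \<Rightarrow> 'v list) \<Rightarrow> 'v list \<Rightarrow> 'v set \<Rightarrow> real" where
  "oriented_simplex ori vs = (\<lambda>z. if z = set vs then rel_sign vs (ori z) else 0)"

definition simplex_boundary :: "('v set \<Rightarrow> 'v list) \<Rightarrow> 'v set \<Rightarrow> 'v set \<Rightarrow> real" where
  "simplex_boundary ori x =
     (\<lambda>z. let vs = ori x in
        if length vs \<le> 1 then 0
        else \<Sum>i<length vs. (-1) ^ i * oriented_simplex ori (take i vs @ drop (Suc i) vs) z)"

definition simplicial_cells :: "'v set set \<Rightarrow> ('v set \<Rightarrow> 'v list) \<Rightarrow> 'v set cell_complex" where
  "simplicial_cells G ori =
     \<lparr>cells = G,
      cell_dim = (\<lambda>x. card x - 1),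
      boundary = simplex_boundary ori,
      meets = (\<lambda>x y. x \<inter> y \<noteq> {})\<rparr>"

definition product_cells ::
    "'c cell_complex \<Rightarrow> 'd cell_complex \<Rightarrow> ('c \<times> 'd) cell_complex" where
  "product_cells K L =
     \<lparr>cells = cells K \<times> cells L,
      cell_dim = (\<lambda>(x, y). cell_dim K x + cell_dim L y),
      boundary = (\<lambda>(x, y) (u, v).
        boundary K x u * (if v = y then 1 else 0)
        + (-1) ^ cell_dim K x * ((if u = x then 1 else 0) * boundary L y v)),
      meets = (\<lambda>(x, y) (u, v). meets K x u \<and> meets L y v)\<rparr>"

section \<open>Interaction cohomology\<close>

text \<open>The degree is an integer, so that the space of cochains of degree \<open>-1\<close> is zero.\<close>

definition interacting_tuples :: "'c cell_complex \<Rightarrow> nat \<Rightarrow> int \<Rightarrow> 'c list set" where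
  "interacting_tuples K k p =
     {t. length t = k \<and> set t \<subseteq> cells K
         \<and> (\<forall>i<k. \<forall>j<k. i \<noteq> j \<longrightarrow> meets K (t ! i) (t ! j))
         \<and> (\<Sum>i<k. int (cell_dim K (t ! i))) = p}"

definition cochains ::
    "'c cell_complex \<Rightarrow> nat \<Rightarrow> int \<Rightarrow> (real, 'c list \<Rightarrow> real) module" where
  "cochains K k p = ring.func_space class_ring (interacting_tuples K k p)"

definition zero_ext :: "'c list set \<Rightarrow> ('c list \<Rightarrow> real) \<Rightarrow> 'c list \<Rightarrow> real" where
  "zero_ext S F = (\<lambda>t. if t \<in> S then F t else 0)"

definition ext_deriv ::
    "'c cell_complex \<Rightarrow> nat \<Rightarrow> int \<Rightarrow> ('c list \<Rightarrow> real) \<Rightarrow> 'c list \<Rightarrow> real" where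
  "ext_deriv K k p F =
     (\<lambda>t\<in>interacting_tuples K k (p + 1).
        \<Sum>j<k. (-1) ^ (\<Sum>i<j. cell_dim K (t ! i))
          * (\<Sum>c\<in>cells K. boundary K (t ! j) c
               * zero_ext (interacting_tuples K k p) F (t[j := c])))"

definition interaction_cohomology ::
    "'c cell_complex \<Rightarrow> nat \<Rightarrow> nat \<Rightarrow> (real, ('c list \<Rightarrow> real) set) module" where
  "interaction_cohomology K k p =
     quotient_module
       ((cochains K k (int p))
          \<lparr>carrier := a_kernel (cochains K k (int p)) (cochains K k (int p + 1))
                        (ext_deriv K k (int p))\<rparr>)
       (ext_deriv K k (int p - 1) ` carrier (cochains K k (int p - 1)))"

end

theory Submission
  imports Defs
begin

text \<open>
  Cancelling nonzero matrix entries one at a time (Gaussian elimination) deforms every finite cochain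
  complex over a field onto a complex with zero differential, spanned by a finite set \<open>B\<close>;
  its cohomology is then the space of functions on \<open>B\<close>. If \<open>h\<close>, \<open>h'\<close> are the
  homotopies and \<open>\<pi>\<close> the projection of the first deformation, then
  \<open>h \<otimes> 1 + (-1)\<^sup>d\<^sup>e\<^sup>g \<pi> \<otimes> h'\<close> deforms the tensor product complex onto
  \<open>B \<times> B'\<close>. Sorting an interacting tuple of product cells into its two components
  identifies the complex of the product with the tensor product of the two complexes, up to the
  Koszul sign of this rearrangement.
\<close>

section \<open>Finite matrices and reductions of cochain complexes\<close>

text \<open>Cohomology is a quotient, and comparing quotients of a tensor product directly would
  mean choosing cocycles and complements throughout. A reduction packages these choices: since
  \<open>D P = 0\<close> and \<open>Q D = 0\<close>, the map \<open>Q\<close> alone identifies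
  cohomology with the functions on the part of \<open>B\<close> of the right degree. The theorem
  then rests on the remark that the part of \<open>B \<times> B'\<close> of degree p is the disjoint
  union of the products of the parts of degrees i and j with i + j = p. Two properties of
  intersection make the tuples fit this scheme. A simplex meets everything that one of its faces
  meets, so the functions vanishing outside the interacting tuples form a subcomplex of the
  functions on all tuples, and the latter are a k-fold tensor power. And product cells intersect
  componentwise, so an interacting tuple of product cells is exactly a pair of interacting
  tuples.\<close>

definition mmul :: "'b set \<Rightarrow> ('a \<Rightarrow> 'b \<Rightarrow> real) \<Rightarrow> ('b \<Rightarrow> 'c \<Rightarrow> real) \<Rightarrow> 'a \<Rightarrow> 'c \<Rightarrow> real" where
  "mmul S M N = (\<lambda>i j. \<Sum>k\<in>S. M i k * N k j)"

lemma mmul_cong: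
  assumes "\<And>k. k \<in> S \<Longrightarrow> M i k = M' i k" "\<And>k. k \<in> S \<Longrightarrow> N k j = N' k j"
  shows "mmul S M N i j = mmul S M' N' i j"
  unfolding mmul_def by (intro sum.cong) (auto simp: assms)

text \<open>This is an equation of functions, valid for all outer indices, so products can be
  rebracketed by plain rewriting; the unit and diagonal laws below need membership in the index
  set.\<close>

lemma mmul_assoc: "mmul S (mmul R M N) L = mmul R M (mmul S N L)"
proof (intro ext)
  fix i j
  have "(\<Sum>k\<in>S. (\<Sum>l\<in>R. M i l * N l k) * L k j) = (\<Sum>k\<in>S. \<Sum>l\<in>R. M i l * (N l k * L k j))"
    by (simp add: sum_distrib_right mult.assoc)
  also have "\<dots> = (\<Sum>l\<in>R. \<Sum>k\<in>S. M i l * (N l k * L k j))"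
    by (rule sum.swap)
  finally show "mmul S (mmul R M N) L i j = mmul R M (mmul S N L) i j"
    by (simp add: mmul_def sum_distrib_left)
qed

lemma mmul_add_left: "mmul S (\<lambda>i j. M i j + N i j) L = (\<lambda>i j. mmul S M L i j + mmul S N L i j)"
  by (simp add: mmul_def sum.distrib algebra_simps)

lemma mmul_add_right: "mmul S L (\<lambda>i j. M i j + N i j) = (\<lambda>i j. mmul S L M i j + mmul S L N i j)"
  by (simp add: mmul_def sum.distrib algebra_simps)

lemma mmul_diff_left: "mmul S (\<lambda>i j. M i j - N i j) L = (\<lambda>i j. mmul S M L i j - mmul S N L i j)"
  by (simp add: mmul_def sum_subtractf algebra_simps)

lemma mmul_eq_0:
  assumes "\<And>k. k \<in> S \<Longrightarrow> M i k = 0 \<or> N k j = 0"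
  shows "mmul S M N i j = 0"
  unfolding mmul_def by (rule sum.neutral) (use assms in auto)

lemma mmul_nonzeroE:
  assumes "mmul S M N i j \<noteq> 0"
  obtains k where "k \<in> S" "M i k \<noteq> 0" "N k j \<noteq> 0"
proof (cases "\<exists>k\<in>S. M i k \<noteq> 0 \<and> N k j \<noteq> 0")
  case False
  then have "mmul S M N i j = 0"
    by (intro mmul_eq_0) blast
  with assms show ?thesis by simp
qed (use that in blast)

definition diag_mat :: "('a \<Rightarrow> real) \<Rightarrow> 'a \<Rightarrow> 'a \<Rightarrow> real" where
  "diag_mat s = (\<lambda>i j. if i = j then s i else 0)"

lemma mmul_diag_left: "finite S \<Longrightarrow> i \<in> S \<Longrightarrow> mmul S (diag_mat s) M i j = s i * M i j"
  by (simp add: mmul_def diag_mat_def if_distrib[of "\<lambda>t. t * _"] cong: if_cong)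

lemma mmul_diag_right: "finite S \<Longrightarrow> j \<in> S \<Longrightarrow> mmul S M (diag_mat s) i j = M i j * s j"
  by (simp add: mmul_def diag_mat_def if_distrib[of "\<lambda>t. _ * t"] cong: if_cong)

lemma mmul_unit_left: "finite S \<Longrightarrow> i \<in> S \<Longrightarrow> mmul S (\<lambda>i j. of_bool (i = j)) M i j = M i j"
  by (simp add: mmul_def of_bool_def if_distrib[of "\<lambda>t. t * _"] cong: if_cong)

lemma mmul_unit_right:
  "finite S \<Longrightarrow> j \<in> S \<Longrightarrow> mmul S M (\<lambda>i j. of_bool (i = j)) i j = M i j"
  by (simp add: mmul_def of_bool_def if_distrib[of "\<lambda>t. _ * t"] cong: if_cong)

definition kron :: "('a \<Rightarrow> 'b \<Rightarrow> real) \<Rightarrow> ('c \<Rightarrow> 'd \<Rightarrow> real) \<Rightarrow> 'a \<times> 'c \<Rightarrow> 'b \<times> 'd \<Rightarrow> real" where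
  "kron M N = (\<lambda>i j. M (fst i) (fst j) * N (snd i) (snd j))"

text \<open>The mixed product rule. No Koszul sign appears, because all signs are carried by
  explicit diagonal factors.\<close>

lemma mmul_kron: "mmul (S \<times> S') (kron M M') (kron N N') = kron (mmul S M N) (mmul S' M' N')"
  by (intro ext) (simp add: mmul_def kron_def sum_product sum.cartesian_product case_prod_beta
      mult_ac)

text \<open>
  Matrices act on functions: \<open>D x y\<close> is the contribution of the value at \<open>y\<close> to the value
  at \<open>x\<close>. Thus \<open>D\<close> raises the degree, and the homotopy \<open>h\<close> below lowers it.
\<close>

locale matrix_complex =
  fixes A :: "'a set" and dg :: "'a \<Rightarrow> int" and D :: "'a \<Rightarrow> 'a \<Rightarrow> real"
  assumes finite_index: "finite A"
    and D_degree: "\<lbrakk>x \<in> A; y \<in> A; D x y \<noteq> 0\<rbrakk> \<Longrightarrow> dg x = dg y + 1"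
    and D_square: "\<lbrakk>x \<in> A; y \<in> A\<rbrakk> \<Longrightarrow> mmul A D D x y = 0"

text \<open>\<open>P\<close> and \<open>Q\<close> are inclusion and projection of a complex on
  \<open>B\<close> with zero differential: \<open>DP\<close> and \<open>QD\<close> say that they are
  chain maps, and \<open>h\<close> deforms the identity to the projection
  \<open>P Q\<close>.\<close>

locale reduction = matrix_complex A dg D
  for A :: "'a set" and dg D +
  fixes B :: "'b set" and eg :: "'b \<Rightarrow> int"
    and P :: "'a \<Rightarrow> 'b \<Rightarrow> real" and Q :: "'b \<Rightarrow> 'a \<Rightarrow> real" and h :: "'a \<Rightarrow> 'a \<Rightarrow> real"
  assumes finite_reduced: "finite B"
    and P_degree: "\<lbrakk>x \<in> A; b \<in> B; P x b \<noteq> 0\<rbrakk> \<Longrightarrow> dg x = eg b"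
    and Q_degree: "\<lbrakk>x \<in> A; b \<in> B; Q b x \<noteq> 0\<rbrakk> \<Longrightarrow> dg x = eg b"
    and h_degree: "\<lbrakk>x \<in> A; y \<in> A; h x y \<noteq> 0\<rbrakk> \<Longrightarrow> dg y = dg x + 1"
    and QP: "\<lbrakk>b \<in> B; c \<in> B\<rbrakk> \<Longrightarrow> mmul A Q P b c = of_bool (b = c)"
    and DP: "\<lbrakk>x \<in> A; b \<in> B\<rbrakk> \<Longrightarrow> mmul A D P x b = 0"
    and QD: "\<lbrakk>b \<in> B; x \<in> A\<rbrakk> \<Longrightarrow> mmul A Q D b x = 0"
    and homotopy: "\<lbrakk>x \<in> A; y \<in> A\<rbrakk> \<Longrightarrow>
      of_bool (x = y) - mmul B P Q x y = mmul A D h x y + mmul A h D x y"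

section \<open>Cancelling one nonzero matrix entry\<close>

locale cancellation = matrix_complex +
  fixes a b
  assumes a: "a \<in> A" and b: "b \<in> A" and ab: "D a b \<noteq> 0"
begin

definition "A' = A - {a, b}"
text \<open>The Schur complement of the pivot \<open>D a b\<close>: from \<open>D x y\<close> one
  subtracts the zigzag from \<open>y\<close> to \<open>a\<close>, back along the inverted pivot to
  \<open>b\<close>, and on to \<open>x\<close>.\<close>

definition "D' x y = D x y - D x b * D a y / D a b"
text \<open>Column \<open>y\<close> is the generator \<open>y\<close> corrected at \<open>b\<close>;
  the coefficient is chosen so that the \<open>a\<close>-component of its differential
  vanishes.\<close>

definition "P' x y = (if x = b then - D a y / D a b else if x = a then 0 else of_bool (x = y))"
text \<open>The transposed correction: the entry at \<open>a\<close> is chosen so that row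
  \<open>x\<close> of \<open>Q' D\<close> vanishes at \<open>b\<close>.\<close>

definition "Q' x y = (if y = a then - D x b / D a b else if y = b then 0 else of_bool (x = y))"
definition "h' x y = (if x = b \<and> y = a then 1 / D a b else 0)"

lemma a_neq_b: "a \<noteq> b"
  using D_degree[OF a b ab] by auto

lemma D_diag: "x \<in> A \<Longrightarrow> D x x = 0"
  using D_degree[of x x] by auto

lemma sum_split: "(\<Sum>z\<in>A. f z) = f a + f b + (\<Sum>z\<in>A'. f z)" for f :: "'a \<Rightarrow> real"
proof -
  have "insert a (insert b (A - {a, b})) = A"
    using a b by auto
  then have "sum f A = sum f (insert a (insert b (A - {a, b})))"
    by simp
  also have "\<dots> = f a + f b + sum f (A - {a, b})"
    using a_neq_b finite_index by simp
  finally show ?thesis by (simp add: A'_def)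
qed

lemma finite': "finite A'"
  using finite_index unfolding A'_def by simp

text \<open>Trades a sum over the surviving indices for the two terms at the pivot; every later use
  of \<open>D D = 0\<close> in this locale goes through this form.\<close>

lemma D_square_split:
  "\<lbrakk>x \<in> A; y \<in> A\<rbrakk> \<Longrightarrow> (\<Sum>z\<in>A'. D x z * D z y) = - D x a * D a y - D x b * D b y"
  using D_square[of x y] unfolding mmul_def sum_split by simp

lemma A'_D: "x \<in> A' \<Longrightarrow> x \<in> A \<and> x \<noteq> a \<and> x \<noteq> b"
  unfolding A'_def by simp

lemma notin_A' [simp]: "a \<notin> A'" "b \<notin> A'"
  unfolding A'_def by simp_all

text \<open>Expanding gives four sums over \<open>A'\<close>. As the diagonal of \<open>D\<close> is
  0 by degree, the last one vanishes, the two middle ones are \<open>- D x a * D a b\<close> and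
  \<open>- D a b * D b y\<close>, and after division by the pivot they cancel the first.\<close>

lemma D'_square: "mmul A' D' D' x y = 0" if "x \<in> A" "y \<in> A"
proof -
  have "mmul A' D' D' x y = (\<Sum>z\<in>A'. D x z * D z y) - (\<Sum>z\<in>A'. D x z * D z b) * (D a y / D a b)
      - (D x b / D a b) * (\<Sum>z\<in>A'. D a z * D z y)
      + (D x b / D a b) * (\<Sum>z\<in>A'. D a z * D z b) * (D a y / D a b)"
    unfolding mmul_def D'_def sum_distrib_left sum_distrib_right
    by (simp add: algebra_simps sum.distrib sum_subtractf)
  also have "\<dots> = 0"
    using ab by (simp add: D_square_split that a b D_diag divide_simps)
  finally show ?thesis .
qed

lemma D'_degree:
  assumes "x \<in> A" "y \<in> A" "D' x y \<noteq> 0"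
  shows "dg x = dg y + 1"
proof (cases "D x y = 0")
  case True
  then have "D x b \<noteq> 0" "D a y \<noteq> 0" using assms unfolding D'_def by auto
  then show ?thesis using D_degree[of x b] D_degree[of a y] D_degree[of a b] assms a b ab by auto
qed (use D_degree assms in auto)

lemma complex': "matrix_complex A' dg D'"
  by unfold_locales (simp_all add: finite' D'_degree D'_square A'_D)

text \<open>In row \<open>a\<close> both sides vanish by the choice of \<open>P'\<close>, and in the
  rows of \<open>A'\<close> the matrix \<open>P'\<close> is the identity; only row \<open>b\<close>
  needs \<open>D D = 0\<close>.\<close>

lemma chain_P: "mmul A D P' x y = mmul A' P' D' x y" if x: "x \<in> A" and y: "y \<in> A'"
proof -
  note y' = A'_D[OF y]
  have "(\<Sum>z\<in>A'. D x z * P' z y) = (\<Sum>z\<in>A'. if z = y then D x z else 0)"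
    by (rule sum.cong[OF refl], frule A'_D) (auto simp: P'_def)
  also have "\<dots> = D x y" using finite' y by simp
  finally have L: "mmul A D P' x y = D' x y"
    using a_neq_b unfolding mmul_def sum_split by (simp add: P'_def D'_def)
  consider "x = b" | "x = a" | "x \<in> A'" using x unfolding A'_def by auto
  then show ?thesis
  proof cases
    case 1
    have "mmul A' P' D' b y = - (1 / D a b) * (\<Sum>z\<in>A'. D a z * D z y)
        + (1 / D a b) * (\<Sum>z\<in>A'. D a z * D z b) * (D a y / D a b)"
      unfolding mmul_def D'_def P'_def sum_distrib_left sum_distrib_right
      by (simp add: algebra_simps sum.distrib sum_subtractf sum_negf)
    also have "\<dots> = D b y"
      using ab y' a b by (simp add: D_square_split D_diag)
    finally show ?thesis using L 1 b D_diag by (simp add: D'_def)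
  next
    case 2
    then show ?thesis using L ab a_neq_b
      by (simp add: D'_def P'_def mmul_def)
  next
    case 3
    have "mmul A' P' D' x y = (\<Sum>z\<in>A'. if z = x then D' z y else 0)"
      unfolding mmul_def by (rule sum.cong) (use A'_D[OF 3] in \<open>auto simp: P'_def\<close>)
    then show ?thesis using L finite' 3 by simp
  qed
qed

lemma chain_Q: "mmul A Q' D x y = mmul A' D' Q' x y" if x: "x \<in> A'" and y: "y \<in> A"
proof -
  note x' = A'_D[OF x]
  have "(\<Sum>z\<in>A'. Q' x z * D z y) = (\<Sum>z\<in>A'. if z = x then D z y else 0)"
    by (rule sum.cong[OF refl], frule A'_D) (auto simp: Q'_def)
  also have "\<dots> = D x y" using finite' x by simp
  finally have L: "mmul A Q' D x y = D' x y"
    using a_neq_b unfolding mmul_def sum_split by (simp add: Q'_def D'_def)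
  consider "y = b" | "y = a" | "y \<in> A'" using y unfolding A'_def by auto
  then show ?thesis
  proof cases
    case 2
    have "mmul A' D' Q' x a = - (1 / D a b) * (\<Sum>z\<in>A'. D x z * D z b)
        + (D x b / D a b) * (\<Sum>z\<in>A'. D a z * D z b) * (1 / D a b)"
      unfolding mmul_def D'_def Q'_def sum_distrib_left sum_distrib_right
      by (simp add: algebra_simps sum.distrib sum_subtractf sum_negf)
    also have "\<dots> = D x a"
      using ab x' a b by (simp add: D_square_split D_diag)
    finally show ?thesis using L 2 a D_diag by (simp add: D'_def)
  next
    case 1
    then show ?thesis using L ab a_neq_b
      by (simp add: D'_def Q'_def mmul_def)
  next
    case 3
    have "mmul A' D' Q' x y = (\<Sum>z\<in>A'. if z = y then D' x z else 0)"
      unfolding mmul_def by (rule sum.cong) (use A'_D[OF 3] in \<open>auto simp: Q'_def\<close>)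
    then show ?thesis using L finite' 3 by simp
  qed
qed

lemma Q'P': "mmul A Q' P' x y = of_bool (x = y)" if x: "x \<in> A'" and y: "y \<in> A'"
proof -
  have "mmul A Q' P' x y = (\<Sum>z\<in>A'. Q' x z * P' z y)"
    using a_neq_b unfolding mmul_def sum_split by (simp add: Q'_def P'_def)
  also have "\<dots> = (\<Sum>z\<in>A'. if z = x then of_bool (x = y) else 0)"
    by (rule sum.cong[OF refl], frule A'_D) (auto simp: Q'_def P'_def)
  finally show ?thesis using finite' x by simp
qed

text \<open>\<open>D h'\<close> lives in column \<open>a\<close> and \<open>h' D\<close> in row
  \<open>b\<close>; elsewhere \<open>P' Q'\<close> agrees with the identity. At the crossing entry
  (\<open>b\<close>, \<open>a\<close>) the entry of \<open>P' Q'\<close> is 0 because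
  \<open>D D\<close> vanishes at (\<open>a\<close>, \<open>b\<close>).\<close>

lemma homotopy': "of_bool (x = y) - mmul A' P' Q' x y = mmul A D h' x y + mmul A h' D x y"
  if x: "x \<in> A" and y: "y \<in> A"
proof -
  have D_h: "mmul A D h' x y = (if y = a then D x b / D a b else 0)"
    using a_neq_b unfolding mmul_def sum_split
    by (auto simp: h'_def finite' if_distrib[of "\<lambda>t. _ * t"] if_distrib[of "\<lambda>t. t * _"]
        cong: if_cong intro!: sum.neutral)
  have h_D: "mmul A h' D x y = (if x = b then D a y / D a b else 0)"
    using a_neq_b unfolding mmul_def sum_split
    by (auto simp: h'_def finite' if_distrib[of "\<lambda>t. _ * t"] if_distrib[of "\<lambda>t. t * _"]
        cong: if_cong intro!: sum.neutral)
  have PQ: "mmul A' P' Q' x y = (if x = b then (\<Sum>z\<in>A'. - D a z / D a b * Q' z y)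
      else if x = a then 0 else Q' x y)"
  proof -
    consider "x = b" | "x = a" | "x \<in> A'" using x unfolding A'_def by auto
    then show ?thesis
    proof cases
      case 3
      have "mmul A' P' Q' x y = (\<Sum>z\<in>A'. if z = x then Q' x y else 0)"
        unfolding mmul_def by (rule sum.cong) (use A'_D[OF 3] in \<open>auto simp: P'_def\<close>)
      then show ?thesis using finite' 3 A'_D by simp
    qed (use a_neq_b in \<open>auto simp: mmul_def P'_def\<close>)
  qed
  have S: "(\<Sum>z\<in>A'. - D a z / D a b * Q' z y) =
      (if y = a then 0 else if y = b then 0 else - D a y / D a b)"
  proof -
    consider "y = b" | "y = a" | "y \<in> A'" using y unfolding A'_def by auto
    then show ?thesis
    proof cases
      case 2
      have "(\<Sum>z\<in>A'. - D a z / D a b * Q' z y) = (\<Sum>z\<in>A'. D a z * D z b) / (D a b * D a b)"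
        using 2 unfolding Q'_def sum_divide_distrib by simp
      then show ?thesis using 2 by (simp add: D_square_split a b D_diag)
    next
      case 3
      have "(\<Sum>z\<in>A'. - D a z / D a b * Q' z y) = (\<Sum>z\<in>A'. if z = y then - D a z / D a b else 0)"
        by (rule sum.cong) (use A'_D[OF 3] in \<open>auto simp: Q'_def\<close>)
      then show ?thesis using finite' 3 A'_D by simp
    qed (use a_neq_b in \<open>auto simp: Q'_def\<close>)
  qed
  show ?thesis
    unfolding D_h h_D PQ S using a_neq_b ab a b D_diag by (auto simp: Q'_def)
qed

text \<open>Composition of deformations:
  \<open>1 - P' P2 Q2 Q' = (1 - P' Q') + P' (1 - P2 Q2) Q'\<close>, and the chain map equations
  carry \<open>D\<close> through \<open>P'\<close> and \<open>Q'\<close>, turning it into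
  \<open>D'\<close>.\<close>

lemma reduction_compose:
  assumes "reduction A' dg D' B eg P2 Q2 h2"
  shows "reduction A dg D B eg (mmul A' P' P2) (mmul A' Q2 Q')
    (\<lambda>x y. h' x y + mmul A' P' (mmul A' h2 Q') x y)"
proof -
  interpret R: reduction A' dg D' B eg P2 Q2 h2 by fact
  have P'_deg: "dg x = dg y" if "x \<in> A" "y \<in> A'" "P' x y \<noteq> 0" for x y
    using that D_degree[of a y] D_degree[of a b] a b ab A'_D[of y]
    by (auto simp: P'_def split: if_splits)
  have Q'_deg: "dg x = dg y" if "x \<in> A'" "y \<in> A" "Q' x y \<noteq> 0" for x y
    using that D_degree[of x b] D_degree[of a b] a b ab A'_D[of x]
    by (auto simp: Q'_def split: if_splits)
  show ?thesis
  proof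
    show "finite B" by (rule R.finite_reduced)
    show "dg x = eg c" if "x \<in> A" "c \<in> B" "mmul A' P' P2 x c \<noteq> 0" for x c
      using that(3) by (elim mmul_nonzeroE) (use that P'_deg R.P_degree in metis)
    show "dg x = eg c" if "x \<in> A" "c \<in> B" "mmul A' Q2 Q' c x \<noteq> 0" for x c
      using that(3) by (elim mmul_nonzeroE) (use that Q'_deg R.Q_degree in metis)
    show "dg y = dg x + 1" if xy: "x \<in> A" "y \<in> A"
      and nz: "h' x y + mmul A' P' (mmul A' h2 Q') x y \<noteq> 0" for x y
    proof (cases "h' x y = 0")
      case True
      then have "mmul A' P' (mmul A' h2 Q') x y \<noteq> 0" using nz by simp
      then obtain z w where "z \<in> A'" "P' x z \<noteq> 0" "w \<in> A'" "h2 z w \<noteq> 0" "Q' w y \<noteq> 0"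
        by (metis mmul_nonzeroE)
      then show ?thesis using P'_deg[of x z] Q'_deg[of w y] R.h_degree[of z w] xy by simp
    qed (use D_degree[OF a b ab] in \<open>auto simp: h'_def split: if_splits\<close>)
    show "mmul A (mmul A' Q2 Q') (mmul A' P' P2) c d = of_bool (c = d)" if "c \<in> B" "d \<in> B" for c d
    proof -
      have "mmul A (mmul A' Q2 Q') (mmul A' P' P2) c d
          = mmul A' Q2 (mmul A' (mmul A Q' P') P2) c d"
        by (simp add: mmul_assoc)
      also have "\<dots> = mmul A' Q2 P2 c d"
        by (rule mmul_cong[OF refl])
          (simp add: mmul_def[of A' "mmul A Q' P'"] Q'P' of_bool_def if_distrib[of "\<lambda>t. t * _"]
            finite' cong: if_cong)
      finally show ?thesis using R.QP that by simp
    qed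
    show "mmul A D (mmul A' P' P2) x c = 0" if "x \<in> A" "c \<in> B" for x c
    proof -
      have "mmul A D (mmul A' P' P2) x c = mmul A' (mmul A D P') P2 x c"
        by (simp add: mmul_assoc)
      also have "\<dots> = mmul A' (mmul A' P' D') P2 x c"
        by (rule mmul_cong) (simp_all add: chain_P that)
      also have "\<dots> = mmul A' P' (mmul A' D' P2) x c"
        by (simp add: mmul_assoc)
      also have "\<dots> = 0"
        by (rule mmul_eq_0) (simp add: R.DP that)
      finally show ?thesis .
    qed
    show "mmul A (mmul A' Q2 Q') D c x = 0" if "c \<in> B" "x \<in> A" for c x
    proof -
      have "mmul A (mmul A' Q2 Q') D c x = mmul A' Q2 (mmul A Q' D) c x"
        by (simp add: mmul_assoc)
      also have "\<dots> = mmul A' Q2 (mmul A' D' Q') c x"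
        by (rule mmul_cong) (simp_all add: chain_Q that)
      also have "\<dots> = mmul A' (mmul A' Q2 D') Q' c x"
        by (simp add: mmul_assoc)
      also have "\<dots> = 0"
        by (rule mmul_eq_0) (simp add: R.QD that)
      finally show ?thesis .
    qed
    show "of_bool (x = y) - mmul B (mmul A' P' P2) (mmul A' Q2 Q') x y =
        mmul A D (\<lambda>x y. h' x y + mmul A' P' (mmul A' h2 Q') x y) x y +
        mmul A (\<lambda>x y. h' x y + mmul A' P' (mmul A' h2 Q') x y) D x y"
      if "x \<in> A" "y \<in> A" for x y
    proof -
      have "mmul A D (mmul A' P' (mmul A' h2 Q')) x y
          = mmul A' (mmul A D P') (mmul A' h2 Q') x y"
        by (simp add: mmul_assoc)
      also have "\<dots> = mmul A' (mmul A' P' D') (mmul A' h2 Q') x y"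
        by (rule mmul_cong) (simp_all add: chain_P that)
      also have "\<dots> = mmul A' P' (mmul A' (mmul A' D' h2) Q') x y"
        by (simp add: mmul_assoc)
      finally have 1: "mmul A D (mmul A' P' (mmul A' h2 Q')) x y
          = mmul A' P' (mmul A' (mmul A' D' h2) Q') x y" .
      have "mmul A (mmul A' P' (mmul A' h2 Q')) D x y
          = mmul A' (mmul A' P' h2) (mmul A Q' D) x y"
        by (simp add: mmul_assoc)
      also have "\<dots> = mmul A' (mmul A' P' h2) (mmul A' D' Q') x y"
        by (rule mmul_cong) (simp_all add: chain_Q that)
      also have "\<dots> = mmul A' P' (mmul A' (mmul A' h2 D') Q') x y"
        by (simp add: mmul_assoc)
      finally have 2: "mmul A (mmul A' P' (mmul A' h2 Q')) D x y
          = mmul A' P' (mmul A' (mmul A' h2 D') Q') x y" .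
      have "mmul A' P' (mmul A' (mmul A' D' h2) Q') x y
            + mmul A' P' (mmul A' (mmul A' h2 D') Q') x y
          = mmul A' P' (mmul A' (\<lambda>i j. mmul A' D' h2 i j + mmul A' h2 D' i j) Q') x y"
        by (simp add: mmul_add_left mmul_add_right)
      also have "\<dots> = mmul A' P' (mmul A' (\<lambda>i j. of_bool (i = j) - mmul B P2 Q2 i j) Q') x y"
        by (intro mmul_cong refl) (simp add: R.homotopy)
      also have "\<dots> = mmul A' P' (\<lambda>i j. Q' i j - mmul A' (mmul B P2 Q2) Q' i j) x y"
        unfolding mmul_diff_left
        by (intro mmul_cong refl)
          (simp add: mmul_unit_left finite')
      also have "\<dots> = mmul A' P' Q' x y - mmul A' P' (mmul A' (mmul B P2 Q2) Q') x y"
        by (simp add: mmul_def sum_subtractf right_diff_distrib)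
      also have "mmul A' P' (mmul A' (mmul B P2 Q2) Q') = mmul B (mmul A' P' P2) (mmul A' Q2 Q')"
        by (simp add: mmul_assoc)
      finally show ?thesis
        using homotopy'[OF that] 1 2 by (simp add: mmul_add_left mmul_add_right)
    qed
  qed
qed

end

text \<open>Each cancellation removes two generators, and once no nonzero entry is left the identity
  is a reduction. A surviving generator \<open>b\<close> stands for the column of \<open>P\<close>
  at \<open>b\<close>, but it keeps its old degree; for tuples this makes all degrees on
  \<open>B\<close> nonnegative.\<close>

lemma reduction_exists:
  assumes "matrix_complex A dg D"
  shows "\<exists>B P Q h. B \<subseteq> A \<and> reduction A dg D B dg P Q h"
  using assms
proof (induction "card A" arbitrary: A D rule: less_induct)
  case less
  interpret matrix_complex A dg D by fact
  show ?case
  proof (cases "\<exists>a\<in>A. \<exists>b\<in>A. D a b \<noteq> 0")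
    case True
    then obtain a b where "a \<in> A" "b \<in> A" "D a b \<noteq> 0" by blast
    then interpret C: cancellation A dg D a b by unfold_locales
    have "card C.A' < card A"
      unfolding C.A'_def using C.a finite_index by (auto intro!: psubset_card_mono)
    from less(1)[OF this C.complex'] obtain B P Q h
      where B: "B \<subseteq> C.A'" and R: "reduction C.A' dg C.D' B dg P Q h" by blast
    have "B \<subseteq> A"
      using B unfolding C.A'_def by blast
    with C.reduction_compose[OF R] show ?thesis by (intro exI conjI)
  next
    case False
    have D_0: "D x y = 0" if "x \<in> A" "y \<in> A" for x y
      using False that by blast
    have L: "mmul A D M x y = 0" if "x \<in> A" for x y and M :: "'a \<Rightarrow> 'a \<Rightarrow> real"
      by (rule mmul_eq_0) (use False that in blast)
    have R: "mmul A M D x y = 0" if "y \<in> A" for x y and M :: "'a \<Rightarrow> 'a \<Rightarrow> real"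
      by (rule mmul_eq_0) (use False that in blast)
    have "reduction A dg D A dg (\<lambda>x y. of_bool (x = y)) (\<lambda>x y. of_bool (x = y)) (\<lambda>_ _. 0)"
      using finite_index by unfold_locales (simp_all add: mmul_unit_left mmul_unit_right D_0 L R)
    then show ?thesis by blast
  qed
qed

section \<open>Signs and tensor products of reductions\<close>

definition parity_sign :: "int \<Rightarrow> real" where
  "parity_sign n = (if even n then 1 else -1)"

lemma parity_sign_add: "parity_sign (m + n) = parity_sign m * parity_sign n"
  by (auto simp: parity_sign_def)

lemma parity_sign_square [simp]: "parity_sign n * parity_sign n = 1"
  by (auto simp: parity_sign_def)

lemma parity_sign_cancel [simp]: "parity_sign n * (parity_sign n * x) = x"
  by (simp add: mult.assoc[symmetric])

lemma parity_sign_one [simp]: "parity_sign 1 = - 1" "parity_sign 0 = 1"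
  by (auto simp: parity_sign_def)

lemma parity_sign_of_nat: "parity_sign (int n) = (-1) ^ n"
  by (auto simp: parity_sign_def)

text \<open>The graded Leibniz rule, \<open>D \<otimes> 1 + s \<otimes> D'\<close> with
  \<open>s\<close> the sign of the degree.\<close>

definition tensor_differential ::
  "('a \<Rightarrow> int) \<Rightarrow> ('a \<Rightarrow> 'a \<Rightarrow> real) \<Rightarrow> ('b \<Rightarrow> 'b \<Rightarrow> real) \<Rightarrow> 'a \<times> 'b \<Rightarrow> 'a \<times> 'b \<Rightarrow> real" where
  "tensor_differential dg D D' = (\<lambda>i j. kron D (\<lambda>i j. of_bool (i = j)) i j
     + kron (diag_mat (\<lambda>x. parity_sign (dg x))) D' i j)"

lemma kron_apply: "kron M N (a, b) (c, d) = M a c * N b d"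
  by (simp add: kron_def)

context matrix_complex
begin

abbreviation "s x \<equiv> parity_sign (dg x)"

lemma D_sign: "x \<in> A \<Longrightarrow> y \<in> A \<Longrightarrow> D x y * s y = - s x * D x y"
  using D_degree[of x y] by (cases "D x y = 0") (auto simp: parity_sign_add)

lemma D_diag_sign: "x \<in> A \<Longrightarrow> y \<in> A \<Longrightarrow> mmul A D (diag_mat s) x y = - s x * D x y"
  by (simp add: mmul_diag_right finite_index D_sign)

end

text \<open>The squares of the two summands vanish with \<open>D D\<close> and \<open>D' D'\<close>.
  The mixed terms are \<open>D s \<otimes> D'\<close> and \<open>s D \<otimes> D'\<close>; they
  cancel because \<open>D\<close> changes the parity of the degree.\<close>

lemma tensor_complex:
  assumes "matrix_complex A dg D" "matrix_complex A' dg' D'"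
  shows "matrix_complex (A \<times> A') (\<lambda>x. dg (fst x) + dg' (snd x)) (tensor_differential dg D D')"
proof -
  interpret L: matrix_complex A dg D by fact
  interpret R: matrix_complex A' dg' D' by fact
  show ?thesis
  proof
    show "finite (A \<times> A')" by (simp add: L.finite_index R.finite_index)
    show "dg (fst x) + dg' (snd x) = dg (fst y) + dg' (snd y) + 1"
      if "x \<in> A \<times> A'" "y \<in> A \<times> A'" "tensor_differential dg D D' x y \<noteq> 0" for x y
      using that L.D_degree[of "fst x" "fst y"] R.D_degree[of "snd x" "snd y"]
      by (cases "D (fst x) (fst y) = 0"; cases "D' (snd x) (snd y) = 0")
        (auto simp: tensor_differential_def kron_def diag_mat_def split: if_splits)
    show "mmul (A \<times> A') (tensor_differential dg D D') (tensor_differential dg D D') x y = 0"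
      if "x \<in> A \<times> A'" "y \<in> A \<times> A'" for x y
      using that
      by (cases x, cases y)
        (simp add: tensor_differential_def mmul_add_left mmul_add_right mmul_kron kron_apply
          L.D_square R.D_square L.D_diag_sign mmul_diag_left mmul_unit_left mmul_unit_right
          L.finite_index R.finite_index)
  qed
qed

context reduction
begin

abbreviation "PQ \<equiv> mmul B P Q"

lemma PQ_degree: "x \<in> A \<Longrightarrow> y \<in> A \<Longrightarrow> PQ x y \<noteq> 0 \<Longrightarrow> dg x = dg y"
  by (elim mmul_nonzeroE) (simp add: P_degree Q_degree)

text \<open>A mixed term of the tensor homotopy: the sign moves through \<open>D\<close>, after
  which \<open>D P = 0\<close> applies.\<close>

lemma D_sign_PQ: "x \<in> A \<Longrightarrow> y \<in> A \<Longrightarrow> mmul A D (mmul A (diag_mat s) PQ) x y = 0"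
proof -
  assume xy: "x \<in> A" "y \<in> A"
  have "mmul A D (mmul A (diag_mat s) PQ) x y = mmul A (mmul A D (diag_mat s)) PQ x y"
    by (simp add: mmul_assoc)
  also have "\<dots> = mmul A (\<lambda>x y. - s x * D x y) PQ x y"
    by (rule mmul_cong) (simp_all add: D_diag_sign xy)
  also have "\<dots> = - s x * mmul A D PQ x y"
    by (simp add: mmul_def sum_distrib_left mult.assoc sum_negf)
  also have "mmul A D PQ x y = mmul B (mmul A D P) Q x y"
    by (simp add: mmul_assoc)
  also have "\<dots> = 0"
    by (rule mmul_eq_0) (simp add: DP xy)
  finally show ?thesis by simp
qed

lemma sign_PQ_D: "x \<in> A \<Longrightarrow> y \<in> A \<Longrightarrow> mmul A (mmul A (diag_mat s) PQ) D x y = 0"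
  unfolding mmul_assoc by (rule mmul_eq_0, rule disjI2, rule mmul_eq_0) (simp add: QD)

lemma sign_sign_PQ:
  "x \<in> A \<Longrightarrow> y \<in> A \<Longrightarrow> mmul A (diag_mat s) (mmul A (diag_mat s) PQ) x y = PQ x y"
  by (simp add: mmul_diag_left finite_index mult.assoc[symmetric])

text \<open>\<open>P Q\<close> preserves the degree, so the two signs agree and cancel.\<close>

lemma sign_PQ_sign:
  "x \<in> A \<Longrightarrow> y \<in> A \<Longrightarrow> mmul A (mmul A (diag_mat s) PQ) (diag_mat s) x y = PQ x y"
  using PQ_degree[of x y]
  by (cases "PQ x y = 0") (simp_all add: mmul_diag_left mmul_diag_right finite_index)

lemma h_sign: "x \<in> A \<Longrightarrow> y \<in> A \<Longrightarrow> h x y * s y = - s x * h x y"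
  using h_degree[of x y] by (cases "h x y = 0") (auto simp: parity_sign_add)

end

text \<open>With \<open>\<pi> = P Q\<close>, the homotopy and the differential combine to
  \<open>(D h + h D) \<otimes> 1 + \<pi> \<otimes> (D' h' + h' D')\<close>, that is \<open>(1 -
  \<pi>) \<otimes> 1 + \<pi> \<otimes> (1 - \<pi>') = 1 - \<pi> \<otimes> \<pi>'\<close>. The terms
  \<open>h s \<otimes> D'\<close> and \<open>s h \<otimes> D'\<close> cancel since \<open>h\<close>
  changes parity, and the mixed terms with \<open>h'\<close> vanish since
  \<open>D \<pi> = 0 = \<pi> D\<close>.\<close>

lemma reduction_tensor:
  assumes "reduction A dg D B eg P Q h" "reduction A' dg' D' B' eg' P' Q' h'"
  shows "reduction (A \<times> A') (\<lambda>x. dg (fst x) + dg' (snd x)) (tensor_differential dg D D')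
    (B \<times> B') (\<lambda>b. eg (fst b) + eg' (snd b)) (kron P P') (kron Q Q')
    (\<lambda>i j. kron h (\<lambda>i j. of_bool (i = j)) i j
       + kron (mmul A (diag_mat (\<lambda>x. parity_sign (dg x))) (mmul B P Q)) h' i j)"
proof -
  interpret L: reduction A dg D B eg P Q h by fact
  interpret R: reduction A' dg' D' B' eg' P' Q' h' by fact
  note fin = L.finite_index R.finite_index L.finite_reduced R.finite_reduced
  note ev = mmul_add_left mmul_add_right mmul_kron kron_apply mmul_unit_left mmul_unit_right fin
    mmul_diag_left
  interpret T: matrix_complex "A \<times> A'" "\<lambda>x. dg (fst x) + dg' (snd x)" "tensor_differential dg D D'"
    by (rule tensor_complex) unfold_locales
  show ?thesis
  proof (unfold_locales, goal_cases)
    case 1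
    then show ?case by (simp add: fin)
  next
    case (2 x b)
    then show ?case
      using L.P_degree[of "fst x" "fst b"] R.P_degree[of "snd x" "snd b"] by (auto simp: kron_def)
  next
    case (3 x b)
    then show ?case
      using L.Q_degree[of "fst x" "fst b"] R.Q_degree[of "snd x" "snd b"] by (auto simp: kron_def)
  next
    case (4 x y)
    have mem: "fst x \<in> A" "fst y \<in> A" "snd x \<in> A'" "snd y \<in> A'"
      using 4 by auto
    consider "h (fst x) (fst y) \<noteq> 0" "snd x = snd y"
      | "mmul A (diag_mat L.s) L.PQ (fst x) (fst y) \<noteq> 0" "h' (snd x) (snd y) \<noteq> 0"
    proof -
      have "h (fst x) (fst y) * of_bool (snd x = snd y) \<noteq> 0 \<or>
          mmul A (diag_mat L.s) L.PQ (fst x) (fst y) * h' (snd x) (snd y) \<noteq> 0"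
        using 4(3) by (auto simp: kron_def)
      then show ?thesis using that by auto
    qed
    then show ?case
    proof cases
      case 1
      then show ?thesis using L.h_degree mem by simp
    next
      case 2
      then have "L.PQ (fst x) (fst y) \<noteq> 0"
        using mem by (simp add: mmul_diag_left fin)
      from L.PQ_degree[OF mem(1,2) this] R.h_degree[OF mem(3,4) 2(2)] show ?thesis by simp
    qed
  next
    case (5 b c)
    then show ?case by (cases b, cases c) (simp add: ev L.QP R.QP)
  next
    case (6 x b)
    then show ?case by (cases x, cases b) (simp add: ev tensor_differential_def L.DP R.DP)
  next
    case (7 b x)
    have "mmul A Q (diag_mat L.s) (fst b) (fst x) = Q (fst b) (fst x) * L.s (fst x)"
      using 7 by (auto simp: mmul_diag_right fin)
    then show ?case using 7 by (cases x, cases b) (simp add: ev tensor_differential_def L.QD R.QD)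
  next
    case (8 x y)
    obtain a a' b b' where xy: "x = (a, a')" "y = (b, b')" "a \<in> A" "a' \<in> A'" "b \<in> A" "b' \<in> A'"
      using 8 by auto
    have "mmul A h (diag_mat L.s) a b = - L.s a * h a b"
      using xy by (simp add: mmul_diag_right fin L.h_sign)
    moreover have "mmul A (diag_mat L.s) h a b = L.s a * h a b"
      using xy by (simp add: mmul_diag_left fin)
    moreover have "L.PQ a b * (mmul A' D' h' a' b' + mmul A' h' D' a' b')
        = L.PQ a b * (of_bool (a' = b') - R.PQ a' b')"
      using xy by (simp add: R.homotopy)
    moreover have "(mmul A D h a b + mmul A h D a b) * of_bool (a' = b')
        = (of_bool (a = b) - L.PQ a b) * of_bool (a' = b')"
      using xy by (simp add: L.homotopy)
    moreover have "of_bool (x = y) = of_bool (a = b) * (of_bool (a' = b') :: real)"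
      using xy by auto
    ultimately show ?case
      using xy(3-) unfolding xy(1,2) tensor_differential_def mmul_add_left mmul_add_right mmul_kron
      by (simp add: kron_apply mmul_unit_left mmul_unit_right fin L.D_sign_PQ L.sign_PQ_D
          L.sign_sign_PQ L.sign_PQ_sign algebra_simps)
  qed
qed

section \<open>Transport along bijections and restriction to subcomplexes\<close>

text \<open>\<open>D2\<close> is \<open>D\<close> conjugated by the bijection \<open>f\<close> and
  by the diagonal matrix of the signs \<open>s\<close>, which is its own inverse.\<close>

lemma complex_transport:
  assumes "matrix_complex A dg D"
    and f: "bij_betw f A2 A"
    and deg: "\<And>x. x \<in> A2 \<Longrightarrow> dg2 x = dg (f x)"
    and sign: "\<And>x. x \<in> A2 \<Longrightarrow> s x * s x = 1"
    and D2: "\<And>x y. x \<in> A2 \<Longrightarrow> y \<in> A2 \<Longrightarrow> D2 x y = s x * s y * D (f x) (f y)"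
  shows "matrix_complex A2 dg2 D2"
proof -
  interpret R: matrix_complex A dg D by fact
  have f_mem [simp]: "f x \<in> A" if "x \<in> A2" for x
    using f that by (auto simp: bij_betw_def)
  show ?thesis
  proof (unfold_locales, goal_cases)
    case 1
    then show ?case using bij_betw_finite[OF f] R.finite_index by simp
  next
    case (2 x y)
    then show ?case using R.D_degree[of "f x" "f y"] by (simp add: D2 deg)
  next
    case (3 x y)
    have "mmul A2 D2 D2 x y = (\<Sum>k\<in>A2. s x * s y * (s k * s k) * (D (f x) (f k) * D (f k) (f y)))"
      unfolding mmul_def by (rule sum.cong) (simp_all add: D2 3)
    also have "\<dots> = (\<Sum>k\<in>A2. s x * s y * (D (f x) (f k) * D (f k) (f y)))"
      by (rule sum.cong) (simp_all add: sign)
    also have "\<dots> = (\<Sum>k\<in>A. s x * s y * (D (f x) k * D k (f y)))"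
      by (rule sum.reindex_bij_betw[OF f])
    also have "\<dots> = s x * s y * mmul A D D (f x) (f y)"
      by (simp add: mmul_def sum_distrib_left)
    finally show ?case using 3 by (simp add: R.D_square)
  qed
qed

lemma reduction_transport:
  assumes "reduction A dg D B eg P Q h"
    and f: "bij_betw f A2 A"
    and deg: "\<And>x. x \<in> A2 \<Longrightarrow> dg2 x = dg (f x)"
    and sign: "\<And>x. x \<in> A2 \<Longrightarrow> s x * s x = 1"
    and D2: "\<And>x y. x \<in> A2 \<Longrightarrow> y \<in> A2 \<Longrightarrow> D2 x y = s x * s y * D (f x) (f y)"
  shows "reduction A2 dg2 D2 B eg (\<lambda>x b. s x * P (f x) b) (\<lambda>b x. s x * Q b (f x))
    (\<lambda>x y. s x * s y * h (f x) (f y))"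
proof -
  interpret R: reduction A dg D B eg P Q h by fact
  interpret matrix_complex A2 dg2 D2
    by (rule complex_transport[OF R.matrix_complex_axioms f, where s = s])
      (simp_all add: deg sign D2)
  have f_mem [simp]: "f x \<in> A" if "x \<in> A2" for x
    using f that by (auto simp: bij_betw_def)
  have f_eq: "f x = f y \<longleftrightarrow> x = y" if "x \<in> A2" "y \<in> A2" for x y
    using f that by (auto simp: bij_betw_def inj_on_def)
  \<comment> \<open>The common pattern of all conjugated products: the two signs of the middle index
    multiply to 1, and the sum is reindexed along \<open>f\<close>.\<close>
  have mult: "mmul A2 M N x y = c * mmul A M' N' x' y'"
    if "\<And>k. k \<in> A2 \<Longrightarrow> M x k * N k y = c * (s k * s k) * (M' x' (f k) * N' (f k) y')"
    for M N x y c and M' :: "'x \<Rightarrow> 'a \<Rightarrow> real" and N' :: "'a \<Rightarrow> 'y \<Rightarrow> real" and x' y'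
  proof -
    have "mmul A2 M N x y = (\<Sum>k\<in>A2. c * (M' x' (f k) * N' (f k) y'))"
      unfolding mmul_def by (rule sum.cong) (simp_all add: that sign)
    also have "\<dots> = (\<Sum>k\<in>A. c * (M' x' k * N' k y'))"
      by (rule sum.reindex_bij_betw[OF f])
    finally show ?thesis by (simp add: mmul_def sum_distrib_left)
  qed
  show ?thesis
  proof (unfold_locales, goal_cases)
    case 1
    then show ?case by (rule R.finite_reduced)
  next
    case (2 x b)
    then show ?case using R.P_degree[of "f x" b] by (simp add: deg)
  next
    case (3 x b)
    then show ?case using R.Q_degree[of "f x" b] by (simp add: deg)
  next
    case (4 x y)
    then show ?case using R.h_degree[of "f x" "f y"] by (simp add: deg)
  next
    case (5 b c)
    have "mmul A2 (\<lambda>b x. s x * Q b (f x)) (\<lambda>x b. s x * P (f x) b) b c = 1 * mmul A Q P b c"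
      by (rule mult) simp
    then show ?case using 5 by (simp add: R.QP)
  next
    case (6 x b)
    have "mmul A2 D2 (\<lambda>x b. s x * P (f x) b) x b = s x * mmul A D P (f x) b"
      by (rule mult) (simp add: D2 6)
    then show ?case using 6 by (simp add: R.DP)
  next
    case (7 b x)
    have "mmul A2 (\<lambda>b x. s x * Q b (f x)) D2 b x = s x * mmul A Q D b (f x)"
      by (rule mult) (simp add: D2 7)
    then show ?case using 7 by (simp add: R.QD)
  next
    case (8 x y)
    have "mmul A2 D2 (\<lambda>x y. s x * s y * h (f x) (f y)) x y = (s x * s y) * mmul A D h (f x) (f y)"
      by (rule mult) (simp add: D2 8)
    moreover have "mmul A2 (\<lambda>x y. s x * s y * h (f x) (f y)) D2 x y
        = (s x * s y) * mmul A h D (f x) (f y)"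
      by (rule mult) (simp add: D2 8)
    moreover have "mmul B (\<lambda>x b. s x * P (f x) b) (\<lambda>b x. s x * Q b (f x)) x y
        = (s x * s y) * mmul B P Q (f x) (f y)"
      by (simp add: mmul_def sum_distrib_left mult_ac)
    moreover have "(s x * s y) * (of_bool (f x = f y) - mmul B P Q (f x) (f y))
        = (s x * s y) * (mmul A D h (f x) (f y) + mmul A h D (f x) (f y))"
      using 8 by (simp add: R.homotopy)
    moreover have "(s x * s y) * of_bool (f x = f y) = of_bool (x = y)"
      using 8 by (cases "x = y") (simp_all add: f_eq sign)
    ultimately show ?case by (simp add: algebra_simps)
  qed
qed

text \<open>\<open>closed\<close> says that \<open>D\<close> maps functions supported on
  \<open>A0\<close> to functions supported on \<open>A0\<close>; hence every intermediate index
  contributing to \<open>D D\<close> from a \<open>y\<close> in \<open>A0\<close> lies in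
  \<open>A0\<close> already.\<close>

lemma complex_restrict:
  assumes "matrix_complex A dg D" "A0 \<subseteq> A"
    and closed: "\<And>x y. \<lbrakk>x \<in> A; y \<in> A0; D x y \<noteq> 0\<rbrakk> \<Longrightarrow> x \<in> A0"
  shows "matrix_complex A0 dg D"
proof -
  interpret matrix_complex A dg D by fact
  have "mmul A0 D D x y = mmul A D D x y" if "y \<in> A0" for x y
    unfolding mmul_def by (rule sum.mono_neutral_left) (use finite_index assms that in auto)
  then show ?thesis
    using assms(2) finite_index D_degree D_square
    by unfold_locales (blast intro: finite_subset, blast, simp add: subset_iff)
qed

section \<open>The boundary operator of an oriented simplicial complex\<close>

text \<open>A permutation of \<open>set vs\<close> is fixed by its values on the entries of
  \<open>vs\<close> and is the identity elsewhere, so the description in \<open>rel_sign\<close> has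
  at most one witness.\<close>

lemma rel_sign_eq_sign:
  assumes "distinct vs" "\<pi> permutes set vs" "map \<pi> vs = ws"
  shows "rel_sign vs ws = real_of_int (sign \<pi>)"
proof -
  have "(THE \<pi>. \<pi> permutes set vs \<and> map \<pi> vs = ws) = \<pi>"
  proof (rule the_equality)
    fix \<sigma> assume s: "\<sigma> permutes set vs \<and> map \<sigma> vs = ws"
    show "\<sigma> = \<pi>"
    proof
      fix x
      show "\<sigma> x = \<pi> x"
      proof (cases "x \<in> set vs")
        case True
        then show ?thesis using s assms(3) by (metis map_eq_conv)
      next
        case False
        then show ?thesis using s assms(2) permutes_not_in by metis
      qed
    qed
  qed (use assms in simp)
  then show ?thesis by (simp add: rel_sign_def)
qed

lemma ex_permutes_map_eq:
  assumes "distinct vs" "distinct ws" "set vs = set ws"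
  obtains \<pi> where "\<pi> permutes set vs" "map \<pi> vs = ws"
proof -
  have len: "length vs = length ws"
    using assms by (metis distinct_card)
  define f where "f x = the (map_of (zip vs ws) x)" for x
  have f: "f (vs ! i) = ws ! i" if "i < length vs" for i
    using that len assms(1) by (simp add: f_def map_of_zip_nth)
  define \<pi> where "\<pi> x = (if x \<in> set vs then f x else x)" for x
  have m: "map \<pi> vs = ws"
    using len by (intro nth_equalityI) (simp_all add: \<pi>_def f)
  have "bij_betw \<pi> (set vs) (set vs)"
  proof -
    have "\<pi> ` set vs = set vs"
      using m assms(3) by (metis list.set_map)
    then show ?thesis
      by (simp add: bij_betw_def eq_card_imp_inj_on)
  qed
  then have "\<pi> permutes set vs"
    by (rule bij_imp_permutes) (simp add: \<pi>_def)
  then show thesis using m that by blast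
qed

text \<open>The permutations act on vertices and not on positions, so the two reorderings simply
  compose, and \<open>sign\<close> is multiplicative.\<close>

lemma rel_sign_trans:
  assumes "distinct us" "distinct vs" "distinct ws" "set us = set vs" "set vs = set ws"
  shows "rel_sign us vs * rel_sign vs ws = rel_sign us ws"
proof -
  obtain \<pi> where p: "\<pi> permutes set us" "map \<pi> us = vs"
    using ex_permutes_map_eq assms by metis
  obtain \<sigma> where s: "\<sigma> permutes set vs" "map \<sigma> vs = ws"
    using ex_permutes_map_eq assms by metis
  have "\<sigma> \<circ> \<pi> permutes set us"
    using p(1) s(1) unfolding assms(4) by (rule permutes_compose)
  moreover have "map (\<sigma> \<circ> \<pi>) us = ws"
    using p(2) s(2) by (metis map_map)
  ultimately have "rel_sign us ws = real_of_int (sign (\<sigma> \<circ> \<pi>))"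
    using assms(1) by (intro rel_sign_eq_sign)
  moreover have "permutation \<pi>" "permutation \<sigma>"
    using permutes_imp_permutation[OF List.finite_set] p(1) s(1) by blast+
  moreover have "rel_sign us vs = real_of_int (sign \<pi>)" "rel_sign vs ws = real_of_int (sign \<sigma>)"
    using rel_sign_eq_sign[OF assms(1) p] rel_sign_eq_sign[OF assms(2) s] by simp_all
  ultimately show ?thesis by (simp add: sign_compose)
qed

lemma rel_sign_refl: "distinct us \<Longrightarrow> rel_sign us us = 1"
  using rel_sign_eq_sign[of us id us] by (simp add: permutes_id)

lemma rel_sign_sym:
  assumes "distinct us" "distinct vs" "set us = set vs"
  shows "rel_sign vs us = rel_sign us vs"
proof -
  obtain \<pi> where p: "\<pi> permutes set us" "map \<pi> us = vs"
    using ex_permutes_map_eq assms by metis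
  have "rel_sign us vs = real_of_int (sign \<pi>)"
    by (rule rel_sign_eq_sign[OF assms(1) p])
  then have "rel_sign us vs = 1 \<or> rel_sign us vs = -1"
    by (auto simp: sign_def)
  moreover have "rel_sign us vs * rel_sign vs us = 1"
    using rel_sign_trans[OF assms(1,2,1,3) assms(3)[symmetric]] by (simp add: rel_sign_refl assms(1))
  ultimately show ?thesis by auto
qed

lemma rel_sign_Cons:
  assumes "distinct (u # us)" "distinct (u # vs)" "set us = set vs"
  shows "rel_sign (u # us) (u # vs) = rel_sign us vs"
proof -
  obtain \<pi> where p: "\<pi> permutes set us" "map \<pi> us = vs"
    using ex_permutes_map_eq[of us vs] assms by auto
  have "\<pi> u = u"
    using p(1) assms(1) by (simp add: permutes_not_in)
  moreover have "\<pi> permutes set (u # us)"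
    using p(1) by (rule permutes_subset) auto
  ultimately have "rel_sign (u # us) (u # vs) = real_of_int (sign \<pi>)"
    using p(2) assms(1) by (intro rel_sign_eq_sign) auto
  then show ?thesis
    using rel_sign_eq_sign[OF _ p] assms(1) by simp
qed

lemma rel_sign_swap:
  assumes "distinct (x # y # zs)"
  shows "rel_sign (x # y # zs) (y # x # zs) = -1"
proof -
  have "map (Transposition.transpose x y) zs = zs"
    using assms by (intro map_idI) (auto simp: transpose_def)
  then have "rel_sign (x # y # zs) (y # x # zs) = real_of_int (sign (Transposition.transpose x y))"
    using assms by (intro rel_sign_eq_sign permutes_swap_id) auto
  then show ?thesis using assms by (simp add: sign_swap_id)
qed

text \<open>\<open>u\<close> passes the entries of \<open>xs\<close> one at a time, each adjacent
  exchange contributing -1.\<close>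

lemma rel_sign_move:
  assumes "distinct (xs @ u # ys)"
  shows "rel_sign (xs @ u # ys) (u # xs @ ys) = (-1) ^ length xs"
  using assms
proof (induction xs)
  case Nil
  then show ?case by (simp add: rel_sign_refl del: distinct.simps)
next
  case (Cons x xs)
  have "rel_sign (x # xs @ u # ys) (u # x # xs @ ys)
      = rel_sign (x # xs @ u # ys) (x # u # xs @ ys) * rel_sign (x # u # xs @ ys) (u # x # xs @ ys)"
    using Cons.prems by (intro rel_sign_trans[symmetric]) auto
  also have "rel_sign (x # xs @ u # ys) (x # u # xs @ ys) = rel_sign (xs @ u # ys) (u # xs @ ys)"
    using Cons.prems by (intro rel_sign_Cons) auto
  also have "\<dots> = (-1) ^ length xs"
    using Cons by simp
  also have "rel_sign (x # u # xs @ ys) (u # x # xs @ ys) = -1"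
    using Cons.prems by (intro rel_sign_swap) auto
  finally show ?case by simp
qed

text \<open>The number of entries before the first \<open>u\<close>. Labelling a facet by its
  omitted vertex instead of an index makes facets comparable under different orderings of the same
  simplex.\<close>

definition position :: "'v \<Rightarrow> 'v list \<Rightarrow> nat" where
  "position u us = length (takeWhile (\<lambda>x. x \<noteq> u) us)"

lemma position_append: "u \<notin> set xs \<Longrightarrow> position u (xs @ u # ys) = length xs"
  by (induction xs) (auto simp: position_def)

lemma remove1_split: "u \<notin> set xs \<Longrightarrow> remove1 u (xs @ u # ys) = xs @ ys"
  by (simp add: remove1_append)

text \<open>Bring \<open>u\<close> to the front in both lists, at the cost of its position sign each
  time; what remains is a reordering fixing \<open>u\<close>. This is the sign rule behind the
  independence of the boundary from the chosen ordering.\<close>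

lemma rel_sign_remove1:
  assumes "distinct us" "distinct ws" "set us = set ws" "u \<in> set us"
  shows "rel_sign us ws =
    (-1) ^ position u us * rel_sign (remove1 u us) (remove1 u ws) * (-1) ^ position u ws"
proof -
  have front: "rel_sign vs (u # remove1 u vs) = (-1) ^ position u vs"
    if vs: "distinct vs" "u \<in> set vs" for vs
  proof -
    obtain xs ys where v: "vs = xs @ u # ys" "u \<notin> set xs"
      using vs(2) by (metis split_list_first)
    then show ?thesis
      using rel_sign_move[of xs u ys] vs(1)
      by (simp add: position_append remove1_split del: distinct_append)
  qed
  have rm: "set (remove1 u vs) = set vs - {u}" "distinct (remove1 u vs)" "u \<notin> set (remove1 u vs)"
    if "distinct vs" for vs
    using that by (auto simp: set_remove1_eq)
  have "rel_sign us ws = rel_sign us (u # remove1 u us) * rel_sign (u # remove1 u us) ws"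
    using assms by (intro rel_sign_trans[symmetric]) (auto simp: rm)
  also have "rel_sign (u # remove1 u us) ws
      = rel_sign (u # remove1 u us) (u # remove1 u ws) * rel_sign (u # remove1 u ws) ws"
    using assms by (intro rel_sign_trans[symmetric]) (auto simp: rm)
  also have "rel_sign (u # remove1 u us) (u # remove1 u ws) = rel_sign (remove1 u us) (remove1 u ws)"
    using assms by (intro rel_sign_Cons) (auto simp: rm)
  also have "rel_sign (u # remove1 u ws) ws = (-1) ^ position u ws"
    using assms by (subst rel_sign_sym) (auto simp: rm front)
  finally show ?thesis using assms by (simp add: front)
qed

text \<open>Removing the earlier of two vertices shifts the later one by one place, while removing
  the later leaves the earlier where it is. This single sign is the reason for
  \<open>\<delta> \<delta> = 0\<close>.\<close>

lemma position_remove1_sign: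
  assumes "distinct us" "u \<in> set us" "v \<in> set us" "u \<noteq> v"
  shows "(-1 :: real) ^ position u us * (-1) ^ position v (remove1 u us)
    = - ((-1) ^ position v us * (-1) ^ position u (remove1 v us))"
proof -
  \<comment> \<open>One order of occurrence suffices: the identity is symmetric in the two vertices
    up to moving the minus sign.\<close>
  have ordered: "(-1 :: real) ^ position x us * (-1) ^ position y (remove1 x us)
      = - ((-1) ^ position y us * (-1) ^ position x (remove1 y us))"
    if "us = as @ x # bs @ y # cs" for x y as bs cs
  proof -
    have d: "x \<notin> set as" "y \<notin> set (as @ x # bs)" "y \<notin> set (as @ bs)"
      using assms(1) that by auto
    have "position x us = length as" "remove1 x us = (as @ bs) @ y # cs"
      using position_append[OF d(1)] remove1_split[OF d(1)] that by simp_all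
    moreover have "position y us = length as + length bs + 1" "remove1 y us = as @ x # (bs @ cs)"
      using position_append[OF d(2), of cs] remove1_split[OF d(2), of cs] that by simp_all
    moreover have "position y ((as @ bs) @ y # cs) = length as + length bs"
      using position_append[OF d(3)] by simp
    moreover have "position x (as @ x # (bs @ cs)) = length as"
      using position_append[OF d(1)] by simp
    ultimately show ?thesis by (simp add: power_add)
  qed
  obtain as rest where 1: "us = as @ u # rest" using assms(2) by (metis split_list)
  have "v \<in> set as \<or> v \<in> set rest" using assms(3,4) 1 by auto
  then show ?thesis
  proof
    assume "v \<in> set rest"
    then obtain bs cs where "rest = bs @ v # cs" by (metis split_list)
    with 1 show ?thesis using ordered[of as u bs v cs] by simp
  next
    assume "v \<in> set as"
    then obtain bs cs where "as = bs @ v # cs" by (metis split_list)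
    with 1 show ?thesis using ordered[of bs v cs u rest] by simp
  qed
qed

lemma sum_faces:
  fixes g :: "'v list \<Rightarrow> real"
  assumes "distinct vs"
  shows "(\<Sum>i<length vs. (-1) ^ i * g (take i vs @ drop (Suc i) vs))
    = (\<Sum>u\<in>set vs. (-1) ^ position u vs * g (remove1 u vs))"
proof -
  have "(\<Sum>u\<in>set vs. (-1) ^ position u vs * g (remove1 u vs))
      = (\<Sum>i<length vs. (-1) ^ position (vs ! i) vs * g (remove1 (vs ! i) vs))"
    by (rule sum.reindex_bij_betw[symmetric]) (use assms bij_betw_nth in blast)
  also have "\<dots> = (\<Sum>i<length vs. (-1) ^ i * g (take i vs @ drop (Suc i) vs))"
  proof (rule sum.cong[OF refl])
    fix i assume "i \<in> {..<length vs}"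
    then have i: "i < length vs" by simp
    then have v: "vs = take i vs @ vs ! i # drop (Suc i) vs"
      by (rule id_take_nth_drop)
    then have "vs ! i \<notin> set (take i vs)"
      using assms by (metis disjoint_iff distinct_append list.set_intros(1))
    then have "position (vs ! i) vs = i" "remove1 (vs ! i) vs = take i vs @ drop (Suc i) vs"
      using position_append remove1_split v i by (metis length_take min.absorb4)+
    then show "(-1) ^ position (vs ! i) vs * g (remove1 (vs ! i) vs)
        = (-1) ^ i * g (take i vs @ drop (Suc i) vs)" by simp
  qed
  finally show ?thesis ..
qed

section \<open>The boundary of an oriented simplex and its square\<close>

locale oriented_complex =
  fixes G :: "'v set set" and ori :: "'v set \<Rightarrow> 'v list"
  assumes complex: "simplicial_complex G" and oriented: "orientation G ori"
begin

lemma ori: "x \<in> G \<Longrightarrow> distinct (ori x)" "x \<in> G \<Longrightarrow> set (ori x) = x"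
  using oriented by (auto simp: orientation_def)

lemma simplex: "x \<in> G \<Longrightarrow> finite x" "x \<in> G \<Longrightarrow> x \<noteq> {}" "finite G"
  and face: "x \<in> G \<Longrightarrow> y \<subseteq> x \<Longrightarrow> y \<noteq> {} \<Longrightarrow> y \<in> G"
  using complex unfolding simplicial_complex_def by blast+

lemma length_ori: "x \<in> G \<Longrightarrow> length (ori x) = card x"
  using distinct_card[OF ori(1)] by (simp add: ori)

lemma simplex_boundary_eq:
  assumes "x \<in> G" "card x > 1"
  shows "simplex_boundary ori x z =
    (\<Sum>u\<in>x. (-1) ^ position u (ori x) * oriented_simplex ori (remove1 u (ori x)) z)"
  using sum_faces[OF ori(1)[OF assms(1)], of "\<lambda>us. oriented_simplex ori us z"] assms
  by (simp add: simplex_boundary_def Let_def length_ori ori)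

lemma simplex_boundary_vertex: "x \<in> G \<Longrightarrow> card x \<le> 1 \<Longrightarrow> simplex_boundary ori x z = 0"
  by (simp add: simplex_boundary_def Let_def length_ori)

lemma simplex_boundary_nonzeroD:
  assumes "x \<in> G" "simplex_boundary ori x z \<noteq> 0"
  shows "card x > 1 \<and> z \<subseteq> x \<and> card z = card x - 1"
proof -
  have c: "card x > 1" using assms simplex_boundary_vertex not_le by blast
  obtain u where "u \<in> x" "oriented_simplex ori (remove1 u (ori x)) z \<noteq> 0"
    using assms(2) unfolding simplex_boundary_eq[OF assms(1) c]
    by (auto elim: sum.not_neutral_contains_not_neutral)
  then have "u \<in> x" "z = x - {u}"
    using ori[OF assms(1)] by (auto simp: oriented_simplex_def split: if_splits)
  then show ?thesis using c simplex(1)[OF assms(1)] by auto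
qed

lemma oriented_simplex_change:
  assumes "distinct us" "distinct ws" "set us = set ws" "z \<in> G"
  shows "oriented_simplex ori us z = rel_sign us ws * oriented_simplex ori ws z"
  using assms rel_sign_trans[of us ws "ori z"] ori[of z] by (auto simp: oriented_simplex_def)

text \<open>The boundary may be computed from any ordering of the simplex, up to the sign relating
  it to the chosen one. This is needed because the ordering that a facet inherits from a simplex
  need not be the one that \<open>ori\<close> assigns to it.\<close>

lemma simplex_boundary_reorient:
  assumes x: "x \<in> G" "card x > 1" and us: "distinct us" "set us = x" and z: "z \<in> G"
  shows "rel_sign us (ori x) * simplex_boundary ori x z =
    (\<Sum>u\<in>x. (-1) ^ position u us * oriented_simplex ori (remove1 u us) z)"
  unfolding simplex_boundary_eq[OF x] sum_distrib_left
proof (rule sum.cong[OF refl])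
  fix u assume u: "u \<in> x"
  note o = ori[OF x(1)]
  have "oriented_simplex ori (remove1 u us) z = rel_sign (remove1 u us) (remove1 u (ori x))
      * oriented_simplex ori (remove1 u (ori x)) z"
    by (rule oriented_simplex_change) (use us o z in auto)
  moreover have "rel_sign us (ori x) = (-1) ^ position u us *
      rel_sign (remove1 u us) (remove1 u (ori x)) * (-1) ^ position u (ori x)"
    by (rule rel_sign_remove1) (use us o u in auto)
  ultimately show "rel_sign us (ori x) *
      ((-1) ^ position u (ori x) * oriented_simplex ori (remove1 u (ori x)) z) =
      (-1) ^ position u us * oriented_simplex ori (remove1 u us) z"
    by (simp add: power_add[symmetric] flip: power_mult_distrib mult_2)
qed

lemma simplex_boundary_square:
  assumes x: "x \<in> G" and w: "w \<in> G"
  shows "(\<Sum>z\<in>G. simplex_boundary ori x z * simplex_boundary ori z w) = 0"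
\<comment> \<open>With at most two vertices the facets have at most one, so their boundary is 0 by
  convention. With more than two, every facet has at least two vertices and the formula over omitted
  vertices applies twice.\<close>
proof (cases "card x > 2")
  case False
  have "simplex_boundary ori x z * simplex_boundary ori z w = 0" if "z \<in> G" for z
    using simplex_boundary_nonzeroD[OF x, of z] simplex_boundary_nonzeroD[OF that, of w] False
    by fastforce
  then show ?thesis by simp
next
  case True
  define vs where "vs = ori x"
  have vs: "distinct vs" "set vs = x"
    using ori x by (auto simp: vs_def)
  \<comment> \<open>The contribution of omitting \<open>u\<close> first and \<open>v\<close>
    second.\<close>
  define F where "F u v = (-1) ^ position u vs * ((-1) ^ position v (remove1 u vs) *
    oriented_simplex ori (remove1 v (remove1 u vs)) w)" for u v
  have face_mem: "x - {u} \<in> G \<and> card (x - {u}) > 1" if "u \<in> x" for u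
  proof -
    have "card (x - {u}) > 1" using True that simplex(1)[OF x] by simp
    moreover from this have "x - {u} \<noteq> {}" by force
    ultimately show ?thesis using face[OF x, of "x - {u}"] by auto
  qed
  have "(\<Sum>z\<in>G. simplex_boundary ori x z * simplex_boundary ori z w)
      = (\<Sum>z\<in>G. \<Sum>u\<in>x. (-1) ^ position u vs *
          (oriented_simplex ori (remove1 u vs) z * simplex_boundary ori z w))"
    using True by (simp add: simplex_boundary_eq[OF x] vs_def sum_distrib_right mult.assoc)
  also have "\<dots> = (\<Sum>u\<in>x. (-1) ^ position u vs *
        (\<Sum>z\<in>G. oriented_simplex ori (remove1 u vs) z * simplex_boundary ori z w))"
    by (subst sum.swap) (simp add: sum_distrib_left)
  also have "\<dots> = (\<Sum>u\<in>x. \<Sum>v\<in>x. if u = v then 0 else F u v)"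
  proof (rule sum.cong[OF refl])
    fix u assume u: "u \<in> x"
    let ?us = "remove1 u vs"
    have us: "distinct ?us" "set ?us = x - {u}" using vs by auto
    have "(\<Sum>z\<in>G. oriented_simplex ori ?us z * simplex_boundary ori z w)
        = (\<Sum>z\<in>G. if z = x - {u} then rel_sign ?us (ori z) * simplex_boundary ori z w else 0)"
      by (rule sum.cong) (auto simp: oriented_simplex_def us)
    also have "\<dots> = rel_sign ?us (ori (x - {u})) * simplex_boundary ori (x - {u}) w"
      using simplex(3) face_mem[OF u] by simp
    \<comment> \<open>The sign left over from writing the facet in its chosen orientation is
      absorbed by computing its boundary in the inherited ordering.\<close>
    also have "\<dots> = (\<Sum>v\<in>x - {u}. (-1) ^ position v ?us * oriented_simplex ori (remove1 v ?us) w)"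
      by (rule simplex_boundary_reorient) (use face_mem[OF u] us w in auto)
    finally have "(-1) ^ position u vs *
        (\<Sum>z\<in>G. oriented_simplex ori ?us z * simplex_boundary ori z w) = (\<Sum>v\<in>x - {u}. F u v)"
      by (simp add: F_def sum_distrib_left)
    also have "\<dots> = (\<Sum>v\<in>x. if u = v then 0 else F u v)"
      by (rule sum.mono_neutral_cong_left) (use simplex(1)[OF x] in auto)
    finally show "(-1) ^ position u vs *
        (\<Sum>z\<in>G. oriented_simplex ori ?us z * simplex_boundary ori z w)
        = (\<Sum>v\<in>x. if u = v then 0 else F u v)" .
  qed
  also have "\<dots> = 0"
  proof -
    \<comment> \<open>Both orders of omission reach the same face with opposite signs, so the double
      sum equals its own negative.\<close>
    have anti: "F v u = - F u v" if "u \<in> x" "v \<in> x" "u \<noteq> v" for u v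
    proof -
      have "(-1) ^ position u vs * (-1) ^ position v (remove1 u vs)
          = - ((-1 :: real) ^ position v vs * (-1) ^ position u (remove1 v vs))"
        by (rule position_remove1_sign) (use that vs in auto)
      then have "(-1) ^ position u vs * (-1) ^ position v (remove1 u vs) *
            oriented_simplex ori (remove1 u (remove1 v vs)) w
          = - ((-1) ^ position v vs * (-1) ^ position u (remove1 v vs)) *
            oriented_simplex ori (remove1 u (remove1 v vs)) w"
        by (rule arg_cong)
      then show ?thesis
        unfolding F_def remove1_commute[of v u] by (simp add: mult.assoc)
    qed
    let ?S = "\<Sum>u\<in>x. \<Sum>v\<in>x. if u = v then 0 else F u v"
    have "?S = (\<Sum>u\<in>x. \<Sum>v\<in>x. if v = u then 0 else F v u)"
      by (rule sum.swap)
    also have "\<dots> = (\<Sum>u\<in>x. \<Sum>v\<in>x. - (if u = v then 0 else F u v))"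
    proof (intro sum.cong refl)
      fix u v assume "u \<in> x" "v \<in> x"
      then show "(if v = u then 0 else F v u) = - (if u = v then 0 else F u v)"
        using anti[of u v] by (cases "u = v") simp_all
    qed
    also have "\<dots> = - ?S" by (simp add: sum_negf)
    finally show ?thesis by simp
  qed
  finally show ?thesis .
qed

end

section \<open>Complexes of interacting tuples\<close>

text \<open>Intersection is an arbitrary relation of the record, not assumed symmetric, so
  monotonicity under passing from a boundary cell to the cell is asked in each argument. The
  property is established for the two factors only; the complex of the product is obtained from the
  tensor product.\<close>

definition regular_cells :: "'c cell_complex \<Rightarrow> bool" where
  "regular_cells K \<longleftrightarrow> finite (cells K)
     \<and> (\<forall>c\<in>cells K. \<forall>c'\<in>cells K. boundary K c c' \<noteq> 0 \<longrightarrow>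
          cell_dim K c = cell_dim K c' + 1
          \<and> (\<forall>u. meets K c' u \<longrightarrow> meets K c u) \<and> (\<forall>u. meets K u c' \<longrightarrow> meets K u c))
     \<and> (\<forall>c\<in>cells K. \<forall>c'\<in>cells K. (\<Sum>z\<in>cells K. boundary K c z * boundary K z c') = 0)"

lemma (in oriented_complex) regular_simplicial_cells: "regular_cells (simplicial_cells G ori)"
proof -
  \<comment> \<open>A nonzero boundary coefficient forces \<open>x\<close> to have at least two
    vertices, so the truncated subtractions give the true dimensions.\<close>
  have "card x - 1 = card z - 1 + 1 \<and> (\<forall>u. z \<inter> u \<noteq> {} \<longrightarrow> x \<inter> u \<noteq> {})
      \<and> (\<forall>u. u \<inter> z \<noteq> {} \<longrightarrow> u \<inter> x \<noteq> {})"
    if "x \<in> G" "z \<in> G" "simplex_boundary ori x z \<noteq> 0" for x z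
    using simplex_boundary_nonzeroD[OF that(1,3)] by auto
  then show ?thesis
    unfolding regular_cells_def simplicial_cells_def
    using simplex(3) simplex_boundary_square by simp
qed

definition tuple_dim :: "'c cell_complex \<Rightarrow> 'c list \<Rightarrow> int" where
  "tuple_dim K t = (\<Sum>c\<leftarrow>t. int (cell_dim K c))"

lemma tuple_dim_simps [simp]:
  "tuple_dim K [] = 0" "tuple_dim K (c # t) = int (cell_dim K c) + tuple_dim K t"
  by (simp_all add: tuple_dim_def)

text \<open>The exterior derivative in recursive form: either the head changes and the tail is kept,
  or the head is kept and the tail changes with the sign of the head. This is the tensor
  differential of head and tail. Lists of different lengths get the entry 0.\<close>

fun tuple_boundary :: "'c cell_complex \<Rightarrow> 'c list \<Rightarrow> 'c list \<Rightarrow> real" where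
  "tuple_boundary K (c # t) (c' # t') = boundary K c c' * of_bool (t = t')
     + (if c = c' then parity_sign (int (cell_dim K c)) else 0) * tuple_boundary K t t'"
| "tuple_boundary K _ _ = 0"

definition tuples :: "'c cell_complex \<Rightarrow> nat \<Rightarrow> 'c list set" where
  "tuples K k = {t. length t = k \<and> set t \<subseteq> cells K}"

lemma tuples_0: "tuples K 0 = {[]}"
  by (auto simp: tuples_def)

lemma bij_betw_tuples_Suc: "bij_betw (\<lambda>t. (hd t, tl t)) (tuples K (Suc k)) (cells K \<times> tuples K k)"
proof (rule bij_betwI[where g = "\<lambda>(c, t). c # t"])
  show "(\<lambda>t. (hd t, tl t)) \<in> tuples K (Suc k) \<rightarrow> cells K \<times> tuples K k"
    by (auto simp: tuples_def length_Suc_conv)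
qed (auto simp: tuples_def length_Suc_conv)

lemma sum_tuples_Suc:
  "(\<Sum>t\<in>tuples K (Suc k). f t) = (\<Sum>c\<in>cells K. \<Sum>t\<in>tuples K k. f (c # t))"
proof -
  have "(\<Sum>t\<in>tuples K (Suc k). f t)
      = (\<Sum>t\<in>tuples K (Suc k). (\<lambda>(c, t). f (c # t)) (hd t, tl t))"
    by (rule sum.cong) (auto simp: tuples_def length_Suc_conv)
  also have "\<dots> = (\<Sum>(c, t)\<in>cells K \<times> tuples K k. f (c # t))"
    by (rule sum.reindex_bij_betw[OF bij_betw_tuples_Suc])
  finally show ?thesis by (simp add: sum.cartesian_product)
qed

text \<open>The complex of all k-tuples is the k-fold tensor power of the cells, by splitting off
  the head. Interaction is imposed only afterwards, since the interacting tuples by themselves do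
  not split into head and tail independently.\<close>

lemma tuple_boundary_complex:
  assumes K: "regular_cells K"
  shows "matrix_complex (tuples K k) (tuple_dim K) (tuple_boundary K)"
proof (induction k)
  case 0
  show ?case by unfold_locales (simp_all add: tuples_0 mmul_def)
next
  case (Suc k)
  have cells: "matrix_complex (cells K) (\<lambda>c. int (cell_dim K c)) (boundary K)"
    using K unfolding regular_cells_def by unfold_locales (simp_all add: mmul_def)
  show ?case
  proof (rule complex_transport[OF tensor_complex[OF cells Suc] bij_betw_tuples_Suc, where s = "\<lambda>_. 1"])
    fix t assume t: "t \<in> tuples K (Suc k)"
    then show "tuple_dim K t = int (cell_dim K (fst (hd t, tl t))) + tuple_dim K (snd (hd t, tl t))"
      by (auto simp: tuples_def length_Suc_conv)
    obtain c s where c: "t = c # s" using t by (cases t) (simp_all add: tuples_def)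
    fix t' assume "t' \<in> tuples K (Suc k)"
    then obtain c' s' where c': "t' = c' # s'" by (cases t') (simp_all add: tuples_def)
    show "tuple_boundary K t t' = 1 * 1 *
        tensor_differential (\<lambda>c. int (cell_dim K c)) (boundary K) (tuple_boundary K)
          (hd t, tl t) (hd t', tl t')"
      by (simp add: c c' tensor_differential_def kron_def diag_mat_def)
  qed simp
qed

text \<open>Although only one component can change, the componentwise form suffices: it is what
  interaction, a condition on pairs of components, can be checked against.\<close>

lemma tuple_boundary_nonzeroD:
  assumes "tuple_boundary K t t' \<noteq> 0"
  shows "list_all2 (\<lambda>c c'. c = c' \<or> boundary K c c' \<noteq> 0) t t'"
  using assms
proof (induction K t t' rule: tuple_boundary.induct)
  case (1 K c t c' t')
  then show ?case
    by (cases "boundary K c c' * of_bool (t = t') = 0") (auto simp: list.rel_refl split: if_splits)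
qed auto

definition interacting :: "'c cell_complex \<Rightarrow> nat \<Rightarrow> 'c list set" where
  "interacting K k =
     {t \<in> tuples K k. \<forall>i<k. \<forall>j<k. i \<noteq> j \<longrightarrow> meets K (t ! i) (t ! j)}"

lemma tuple_dim_nth: "tuple_dim K t = (\<Sum>i<length t. int (cell_dim K (t ! i)))"
  by (simp add: tuple_dim_def sum_list_sum_nth atLeast0LessThan)

lemma interacting_tuples_eq: "interacting_tuples K k p = {t \<in> interacting K k. tuple_dim K t = p}"
  by (auto simp: interacting_tuples_def interacting_def tuples_def tuple_dim_nth)

text \<open>Replacing boundary cells by the cells they bound only enlarges what is met, so a tuple
  above an interacting one interacts. Hence extension by zero outside the interacting tuples does
  not destroy \<open>D D = 0\<close>.\<close>

lemma interacting_complex: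
  assumes K: "regular_cells K"
  shows "matrix_complex (interacting K k) (tuple_dim K) (tuple_boundary K)"
proof (rule complex_restrict[OF tuple_boundary_complex[OF K]])
  show "interacting K k \<subseteq> tuples K k"
    by (auto simp: interacting_def)
  fix t t' assume t: "t \<in> tuples K k" and t': "t' \<in> interacting K k" and "tuple_boundary K t t' \<noteq> 0"
  then have rel: "list_all2 (\<lambda>c c'. c = c' \<or> boundary K c c' \<noteq> 0) t t'"
    by (intro tuple_boundary_nonzeroD)
  have mono: "meets K c' u \<Longrightarrow> meets K c u" "meets K u c' \<Longrightarrow> meets K u c"
    if "c = c' \<or> boundary K c c' \<noteq> 0" "c \<in> cells K" "c' \<in> cells K" for c c' u
    using K that unfolding regular_cells_def by metis+
  have "meets K (t ! i) (t ! j)" if ij: "i < k" "j < k" "i \<noteq> j" for i j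
  proof -
    have len: "length t = k" "length t' = k"
      using t t' by (auto simp: tuples_def interacting_def)
    then have "t ! i \<in> cells K" "t' ! i \<in> cells K" "t ! j \<in> cells K" "t' ! j \<in> cells K"
      using t t' ij by (auto simp: tuples_def interacting_def)
    moreover have "t ! i = t' ! i \<or> boundary K (t ! i) (t' ! i) \<noteq> 0"
      "t ! j = t' ! j \<or> boundary K (t ! j) (t' ! j) \<noteq> 0"
      using rel ij len by (auto simp: list_all2_conv_all_nth)
    moreover have "meets K (t' ! i) (t' ! j)"
      using t' ij by (auto simp: interacting_def)
    ultimately show ?thesis using mono by metis
  qed
  with t show "t \<in> interacting K k" by (simp add: interacting_def)
qed

section \<open>The exterior derivative as a matrix\<close>

lemma finite_tuples: "finite (cells K) \<Longrightarrow> finite (tuples K k)"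
  using finite_lists_length_eq[of "cells K" k] by (simp add: tuples_def conj_commute)

text \<open>Position 0 is the head term of the recursion, and all later positions carry the extra
  sign of the head. \<open>g\<close> has to be arbitrary because the induction applies the claim to
  \<open>\<lambda>t'. g (a # t')\<close>.\<close>

lemma sum_boundary_tuple:
  fixes g :: "'c list \<Rightarrow> real"
  assumes "finite (cells K)" "set t \<subseteq> cells K"
  shows "(\<Sum>j<length t. (-1) ^ (\<Sum>i<j. cell_dim K (t ! i)) *
      (\<Sum>c\<in>cells K. boundary K (t ! j) c * g (t[j := c])))
    = (\<Sum>t'\<in>tuples K (length t). tuple_boundary K t t' * g t')"
  using assms(2)
proof (induction t arbitrary: g)
  case Nil
  then show ?case by (simp add: tuples_0)
next
  case (Cons a t)
  have fin: "finite (tuples K (length t))"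
    by (rule finite_tuples[OF assms(1)])
  have mem: "t \<in> tuples K (length t)" "a \<in> cells K"
    using Cons.prems by (auto simp: tuples_def)
  let ?s = "parity_sign (int (cell_dim K a))"
  have 1: "(\<Sum>c\<in>cells K. \<Sum>t'\<in>tuples K (length t). boundary K a c * of_bool (t = t') * g (c # t'))
      = (\<Sum>c\<in>cells K. boundary K a c * g (c # t))"
  proof (rule sum.cong[OF refl])
    fix c
    have "(\<Sum>t'\<in>tuples K (length t). boundary K a c * of_bool (t = t') * g (c # t'))
        = (\<Sum>t'\<in>tuples K (length t). if t' = t then boundary K a c * g (c # t) else 0)"
      by (rule sum.cong) auto
    then show "(\<Sum>t'\<in>tuples K (length t). boundary K a c * of_bool (t = t') * g (c # t'))
        = boundary K a c * g (c # t)"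
      using fin mem by simp
  qed
  have "(\<Sum>c\<in>cells K. \<Sum>t'\<in>tuples K (length t).
        (if a = c then ?s else 0) * tuple_boundary K t t' * g (c # t'))
      = (\<Sum>c\<in>cells K. if c = a then
           \<Sum>t'\<in>tuples K (length t). ?s * tuple_boundary K t t' * g (a # t') else 0)"
    by (rule sum.cong) auto
  also have "\<dots> = ?s * (\<Sum>t'\<in>tuples K (length t). tuple_boundary K t t' * g (a # t'))"
    using assms(1) mem by (simp add: sum_distrib_left mult.assoc)
  also have "\<dots> = ?s * (\<Sum>j<length t. (-1) ^ (\<Sum>i<j. cell_dim K (t ! i)) *
      (\<Sum>c\<in>cells K. boundary K (t ! j) c * g (a # t[j := c])))"
    using Cons.IH[of "\<lambda>t'. g (a # t')"] Cons.prems by simp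
  finally have 2: "(\<Sum>c\<in>cells K. \<Sum>t'\<in>tuples K (length t).
        (if a = c then ?s else 0) * tuple_boundary K t t' * g (c # t'))
      = (\<Sum>j<length t. (-1) ^ (cell_dim K a + (\<Sum>i<j. cell_dim K (t ! i))) *
      (\<Sum>c\<in>cells K. boundary K (t ! j) c * g (a # t[j := c])))"
    by (simp add: sum_distrib_left power_add parity_sign_of_nat mult.assoc)
  have "(\<Sum>t'\<in>tuples K (length (a # t)). tuple_boundary K (a # t) t' * g t')
      = (\<Sum>c\<in>cells K. boundary K a c * g (c # t))
      + (\<Sum>j<length t. (-1) ^ (cell_dim K a + (\<Sum>i<j. cell_dim K (t ! i))) *
      (\<Sum>c\<in>cells K. boundary K (t ! j) c * g (a # t[j := c])))"
    using 1 2 by (simp add: sum_tuples_Suc distrib_right sum.distrib)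
  then show ?case
    by (simp add: sum.lessThan_Suc_shift del: sum.lessThan_Suc)
qed

lemma ext_deriv_eq:
  assumes "finite (cells K)" "t \<in> interacting_tuples K k (p + 1)"
  shows "ext_deriv K k p F t = (\<Sum>t'\<in>interacting_tuples K k p. tuple_boundary K t t' * F t')"
proof -
  have t: "length t = k" "set t \<subseteq> cells K"
    using assms(2) by (auto simp: interacting_tuples_def)
  have "ext_deriv K k p F t
      = (\<Sum>t'\<in>tuples K k. tuple_boundary K t t' * zero_ext (interacting_tuples K k p) F t')"
    using sum_boundary_tuple[OF assms(1) t(2), of "zero_ext (interacting_tuples K k p) F"] assms(2) t(1)
    by (simp add: ext_deriv_def)
  also have "\<dots> = (\<Sum>t'\<in>interacting_tuples K k p. tuple_boundary K t t' * F t')"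
    by (rule sum.mono_neutral_cong_right)
      (auto simp: finite_tuples assms(1) interacting_tuples_eq interacting_def zero_ext_def)
  finally show ?thesis .
qed

section \<open>Tuples of product cells\<close>

lemma product_cells_simps [simp]:
  "cells (product_cells K L) = cells K \<times> cells L"
  "cell_dim (product_cells K L) (x, y) = cell_dim K x + cell_dim L y"
  "boundary (product_cells K L) (x, y) (u, v) = boundary K x u * of_bool (y = v)
    + parity_sign (int (cell_dim K x)) * of_bool (x = u) * boundary L y v"
  "meets (product_cells K L) c c' \<longleftrightarrow> meets K (fst c) (fst c') \<and> meets L (snd c) (snd c')"
  by (auto simp: product_cells_def parity_sign_of_nat case_prod_beta)

text \<open>The sign of moving all components in \<open>L\<close> past those in \<open>K\<close> to their right.\<close>

fun koszul_sign :: "'c cell_complex \<Rightarrow> 'd cell_complex \<Rightarrow> ('c \<times> 'd) list \<Rightarrow> real" where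
  "koszul_sign K L [] = 1"
| "koszul_sign K L (c # t) =
     parity_sign (int (cell_dim L (snd c)) * tuple_dim K (map fst t)) * koszul_sign K L t"

lemma koszul_sign_square: "koszul_sign K L t * koszul_sign K L t = 1"
proof (induction t)
  case (Cons c t)
  have "koszul_sign K L (c # t) * koszul_sign K L (c # t) =
    (parity_sign (int (cell_dim L (snd c)) * tuple_dim K (map fst t))
     * parity_sign (int (cell_dim L (snd c)) * tuple_dim K (map fst t)))
     * (koszul_sign K L t * koszul_sign K L t)"
    by (simp add: mult_ac)
  with Cons show ?case by (simp only: parity_sign_square)
qed simp

abbreviation unzip :: "('c \<times> 'd) list \<Rightarrow> 'c list \<times> 'd list" where
  "unzip t \<equiv> (map fst t, map snd t)"

text \<open>With heads (\<open>c\<close>, \<open>d\<close>), an entry arises from a boundary taken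
  in \<open>c\<close>, in \<open>d\<close>, in the first components of the tail or in its second
  components. The two sides carry the same four terms with different signs, and the Koszul signs of
  \<open>t\<close> and \<open>t'\<close> make up the difference in each case.\<close>

lemma tuple_boundary_product:
  assumes K: "regular_cells K" and L: "regular_cells L"
    and "t \<in> tuples (product_cells K L) k" "t' \<in> tuples (product_cells K L) k"
  shows "tuple_boundary (product_cells K L) t t' = koszul_sign K L t * koszul_sign K L t' *
    tensor_differential (tuple_dim K) (tuple_boundary K) (tuple_boundary L) (unzip t) (unzip t')"
  using assms(3,4)
proof (induction k arbitrary: t t')
  case 0
  then show ?case by (simp add: tuples_def tensor_differential_def kron_def)
next
  case (Suc k)
  obtain c d s where t: "t = (c, d) # s" "s \<in> tuples (product_cells K L) k" "c \<in> cells K" "d \<in> cells L"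
    using Suc.prems(1) by (cases t) (auto simp: tuples_def)
  obtain c' d' s' where t': "t' = (c', d') # s'" "s' \<in> tuples (product_cells K L) k"
      "c' \<in> cells K" "d' \<in> cells L"
    using Suc.prems(2) by (cases t') (auto simp: tuples_def)
  let ?a = "map fst s" and ?b = "map snd s" and ?a' = "map fst s'" and ?b' = "map snd s'"
  let ?e = "koszul_sign K L s" and ?e' = "koszul_sign K L s'"
  let ?c = "int (cell_dim K c)" and ?d = "int (cell_dim L d)" and ?d' = "int (cell_dim L d')"
  have mem: "?a \<in> tuples K k" "?a' \<in> tuples K k"
    using t t' by (auto simp: tuples_def)
  have eq: "s = s' \<longleftrightarrow> ?a = ?a' \<and> ?b = ?b'"
    using t(2) t'(2) by (auto simp: tuples_def intro: pair_list_eqI)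
  note IH = Suc.IH[OF t(2) t'(2)]
  have dim_d: "?d = ?d' + 1" if "boundary L d d' \<noteq> 0"
    using L t t' that by (simp add: regular_cells_def)
  interpret matrix_complex "tuples K k" "tuple_dim K" "tuple_boundary K"
    by (rule tuple_boundary_complex[OF K])
  have dim_a: "tuple_dim K ?a = tuple_dim K ?a' + 1" if "tuple_boundary K ?a ?a' \<noteq> 0"
    using D_degree mem that by blast
  \<comment> \<open>The product of the Koszul signs of the two tuples, which is also their
    quotient.\<close>
  define u where "u = parity_sign (?d * tuple_dim K ?a) * ?e * (parity_sign (?d' * tuple_dim K ?a') * ?e')"
  have e2: "?e * ?e = 1" "?e' * ?e' = 1"
    by (rule koszul_sign_square)+
  \<comment> \<open>The value of \<open>u\<close> for each kind of entry: nothing for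
    \<open>c\<close>; the parity of \<open>?a\<close> for \<open>d\<close>, whose dimension drops by
    one while it has to pass \<open>?a\<close>; the parity of \<open>d\<close> when
    \<open>?a\<close> drops by one; only the signs of the tails when the second components of the
    tail change.\<close>
  have u1: "u = 1" if "s = s'" "d = d'"
  proof -
    have "u = (parity_sign (?d * tuple_dim K ?a) * parity_sign (?d * tuple_dim K ?a)) * (?e * ?e)"
      using that by (simp only: u_def mult_ac)
    then show ?thesis by (simp only: e2 parity_sign_square)
  qed
  have u2: "u = parity_sign (tuple_dim K ?a)" if "s = s'" "boundary L d d' \<noteq> 0"
  proof -
    have "parity_sign (?d * tuple_dim K ?a')
        = parity_sign (?d' * tuple_dim K ?a') * parity_sign (tuple_dim K ?a')"
      by (simp only: dim_d[OF that(2)] distrib_right mult_1 parity_sign_add)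
    then have "u = (parity_sign (?d' * tuple_dim K ?a) * parity_sign (?d' * tuple_dim K ?a))
        * (?e * ?e) * parity_sign (tuple_dim K ?a)"
      by (simp only: u_def that(1) mult_ac)
    then show ?thesis by (simp only: e2 parity_sign_square)
  qed
  have u3: "u = ?e * ?e' * parity_sign ?d" if "tuple_boundary K ?a ?a' \<noteq> 0" "d = d'"
  proof -
    have "parity_sign (?d' * tuple_dim K ?a)
        = parity_sign (?d' * tuple_dim K ?a') * parity_sign ?d'"
      by (simp only: dim_a[OF that(1)] distrib_left mult_1_right parity_sign_add)
    then have "u = (parity_sign (?d * tuple_dim K ?a') * parity_sign (?d * tuple_dim K ?a'))
        * (?e * ?e' * parity_sign ?d)"
      by (simp only: u_def that(2) mult_ac)
    then show ?thesis by (simp only: parity_sign_square)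
  qed
  have u4: "u = ?e * ?e'" if "?a = ?a'" "d = d'"
  proof -
    have "u = (parity_sign (?d * tuple_dim K ?a') * parity_sign (?d * tuple_dim K ?a'))
        * (?e * ?e')"
      using that by (simp only: u_def mult_ac)
    then show ?thesis by (simp only: parity_sign_square)
  qed
  \<comment> \<open>The four terms are matched one by one; whenever the condition under which
    \<open>u\<close> was evaluated fails, both sides are 0.\<close>
  have E1: "boundary K c c' * of_bool (d = d') * of_bool (s = s')
      = u * (boundary K c c' * of_bool (?a = ?a') * of_bool (d # ?b = d' # ?b'))"
  proof (cases "s = s' \<and> d = d'")
    case True
    then show ?thesis by (simp add: u1)
  next
    case False
    then show ?thesis unfolding eq by (auto simp: of_bool_def)
  qed
  have E2: "parity_sign ?c * of_bool (c = c') * boundary L d d' * of_bool (s = s')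
      = u * (parity_sign (?c + tuple_dim K ?a) * of_bool (c # ?a = c' # ?a')
          * (boundary L d d' * of_bool (?b = ?b')))"
  proof (cases "s = s' \<and> boundary L d d' \<noteq> 0")
    case True
    then show ?thesis by (simp add: u2 parity_sign_add mult_ac)
  next
    case False
    then show ?thesis unfolding eq by (auto simp: of_bool_def)
  qed
  have E3: "parity_sign (?c + ?d) * of_bool (c = c' \<and> d = d') * (?e * ?e' *
        (tuple_boundary K ?a ?a' * of_bool (?b = ?b')))
      = u * (parity_sign ?c * of_bool (c = c') * tuple_boundary K ?a ?a'
          * of_bool (d # ?b = d' # ?b'))"
  proof (cases "d = d' \<and> tuple_boundary K ?a ?a' \<noteq> 0")
    case True
    then show ?thesis by (simp add: u3 parity_sign_add mult_ac)
  next
    case False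
    then show ?thesis by (auto simp: of_bool_def)
  qed
  have E4: "parity_sign (?c + ?d) * of_bool (c = c' \<and> d = d') * (?e * ?e' *
        (parity_sign (tuple_dim K ?a) * of_bool (?a = ?a') * tuple_boundary L ?b ?b'))
      = u * (parity_sign (?c + tuple_dim K ?a) * of_bool (c # ?a = c' # ?a')
          * (parity_sign ?d * of_bool (d = d') * tuple_boundary L ?b ?b'))"
  proof (cases "?a = ?a' \<and> d = d'")
    case True
    then show ?thesis by (simp add: u4 parity_sign_add mult_ac)
  next
    case False
    then show ?thesis by (auto simp: of_bool_def)
  qed
  have E5: "tuple_boundary (product_cells K L) t t'
      = boundary K c c' * of_bool (d = d') * of_bool (s = s')
      + parity_sign ?c * of_bool (c = c') * boundary L d d' * of_bool (s = s')
      + (parity_sign (?c + ?d) * of_bool (c = c' \<and> d = d') * (?e * ?e' *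
          (tuple_boundary K ?a ?a' * of_bool (?b = ?b')))
        + parity_sign (?c + ?d) * of_bool (c = c' \<and> d = d') * (?e * ?e' *
          (parity_sign (tuple_dim K ?a) * of_bool (?a = ?a') * tuple_boundary L ?b ?b')))"
  proof -
    have "tuple_boundary (product_cells K L) t t'
        = (boundary K c c' * of_bool (d = d')
          + parity_sign ?c * of_bool (c = c') * boundary L d d') * of_bool (s = s')
        + parity_sign (?c + ?d) * of_bool (c = c' \<and> d = d') * (?e * ?e' *
          (tuple_boundary K ?a ?a' * of_bool (?b = ?b')
          + parity_sign (tuple_dim K ?a) * of_bool (?a = ?a') * tuple_boundary L ?b ?b'))"
      by (simp add: t(1) t'(1) IH tensor_differential_def kron_def diag_mat_def)
    then show ?thesis by (simp only: distrib_left distrib_right)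
  qed
  have E6: "koszul_sign K L t * koszul_sign K L t' *
      tensor_differential (tuple_dim K) (tuple_boundary K) (tuple_boundary L) (unzip t) (unzip t')
    = u * (boundary K c c' * of_bool (?a = ?a') * of_bool (d # ?b = d' # ?b'))
      + u * (parity_sign (?c + tuple_dim K ?a) * of_bool (c # ?a = c' # ?a')
          * (boundary L d d' * of_bool (?b = ?b')))
      + (u * (parity_sign ?c * of_bool (c = c') * tuple_boundary K ?a ?a'
          * of_bool (d # ?b = d' # ?b'))
        + u * (parity_sign (?c + tuple_dim K ?a) * of_bool (c # ?a = c' # ?a')
          * (parity_sign ?d * of_bool (d = d') * tuple_boundary L ?b ?b')))"
  proof -
    have "koszul_sign K L t * koszul_sign K L t' *
        tensor_differential (tuple_dim K) (tuple_boundary K) (tuple_boundary L) (unzip t) (unzip t')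
      = u * ((boundary K c c' * of_bool (?a = ?a') + parity_sign ?c * of_bool (c = c')
            * tuple_boundary K ?a ?a') * of_bool (d # ?b = d' # ?b')
          + parity_sign (?c + tuple_dim K ?a) * of_bool (c # ?a = c' # ?a')
            * (boundary L d d' * of_bool (?b = ?b')
              + parity_sign ?d * of_bool (d = d') * tuple_boundary L ?b ?b'))"
      by (simp add: t(1) t'(1) u_def tensor_differential_def kron_def diag_mat_def)
    then show ?thesis by (simp only: distrib_left distrib_right add_ac)
  qed
  show ?case by (simp only: E5 E6 E1 E2 E3 E4)
qed

text \<open>The meeting relation of the product is a conjunction over the components, so the
  pairwise condition on a tuple of product cells splits into two independent conditions.\<close>

lemma bij_betw_unzip_interacting:
  "bij_betw unzip (interacting (product_cells K L) k) (interacting K k \<times> interacting L k)"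
proof (rule bij_betwI[where g = "\<lambda>(a, b). zip a b"])
  show "unzip \<in> interacting (product_cells K L) k \<rightarrow> interacting K k \<times> interacting L k"
    by (force simp: interacting_def tuples_def case_prod_beta)
  show "(\<lambda>(a, b). zip a b) \<in> interacting K k \<times> interacting L k \<rightarrow> interacting (product_cells K L) k"
  proof
    fix x assume "x \<in> interacting K k \<times> interacting L k"
    then obtain a b where x: "x = (a, b)" "a \<in> interacting K k" "b \<in> interacting L k" by auto
    moreover have "set (zip a b) \<subseteq> cells K \<times> cells L"
      using x by (auto simp: interacting_def tuples_def dest: set_zip_leftD set_zip_rightD)
    ultimately show "(case x of (a, b) \<Rightarrow> zip a b) \<in> interacting (product_cells K L) k"
      by (auto simp: interacting_def tuples_def)
  qed
qed (auto simp: interacting_def tuples_def zip_map_fst_snd)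

lemma tuple_dim_unzip:
  "tuple_dim (product_cells K L) t = tuple_dim K (map fst t) + tuple_dim L (map snd t)"
  by (induction t) (auto simp:)

lemma product_reduction_exists:
  assumes K: "regular_cells K" and L: "regular_cells L"
    and "reduction (interacting K k) (tuple_dim K) (tuple_boundary K) B eg P Q h"
    and "reduction (interacting L k) (tuple_dim L) (tuple_boundary L) B' eg' P' Q' h'"
  shows "\<exists>P Q h. reduction (interacting (product_cells K L) k) (tuple_dim (product_cells K L))
    (tuple_boundary (product_cells K L)) (B \<times> B') (\<lambda>b. eg (fst b) + eg' (snd b)) P Q h"
proof (intro exI, rule reduction_transport[OF reduction_tensor[OF assms(3,4)]
      bij_betw_unzip_interacting, where s = "koszul_sign K L"])
  fix t t' assume "t \<in> interacting (product_cells K L) k" "t' \<in> interacting (product_cells K L) k"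
  then show "tuple_boundary (product_cells K L) t t' = koszul_sign K L t * koszul_sign K L t' *
      tensor_differential (tuple_dim K) (tuple_boundary K) (tuple_boundary L) (unzip t) (unzip t')"
    by (intro tuple_boundary_product[OF K L, where k = k]) (simp_all add: interacting_def)
qed (simp_all add: tuple_dim_unzip koszul_sign_square)

section \<open>Vector spaces isomorphic to spaces of functions\<close>

lemma linear_map_iff:
  "linear_map K V W T \<longleftrightarrow> vectorspace K V \<and> vectorspace K W \<and> T \<in> carrier V \<rightarrow> carrier W
     \<and> (\<forall>x\<in>carrier V. \<forall>y\<in>carrier V. T (x \<oplus>\<^bsub>V\<^esub> y) = T x \<oplus>\<^bsub>W\<^esub> T y)
     \<and> (\<forall>r\<in>carrier K. \<forall>x\<in>carrier V. T (r \<odot>\<^bsub>V\<^esub> x) = r \<odot>\<^bsub>W\<^esub> T x)"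
  unfolding linear_map_def mod_hom_def mod_hom_axioms_def LinearCombinations.module_hom_def
    vectorspace_def by blast

lemma linear_map_zero:
  assumes "linear_map K V W T"
  shows "T \<zero>\<^bsub>V\<^esub> = \<zero>\<^bsub>W\<^esub>"
proof -
  interpret T: linear_map K V W T by fact
  show ?thesis by (rule T.T0_is_0)
qed

text \<open>\<open>X\<close> is only known to carry closed operations; the vector space axioms are
  pulled back along the bijection. This spares verifying them by hand for quotients and direct
  sums.\<close>

lemma linear_map_transport:
  assumes W: "vectorspace K W" and bij: "bij_betw \<Phi> (carrier X) (carrier W)"
    and zero: "\<zero>\<^bsub>X\<^esub> \<in> carrier X" "\<Phi> \<zero>\<^bsub>X\<^esub> = \<zero>\<^bsub>W\<^esub>"
    and add: "\<And>x y. x \<in> carrier X \<Longrightarrow> y \<in> carrier X \<Longrightarrow> x \<oplus>\<^bsub>X\<^esub> y \<in> carrier X"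
      "\<And>x y. x \<in> carrier X \<Longrightarrow> y \<in> carrier X \<Longrightarrow> \<Phi> (x \<oplus>\<^bsub>X\<^esub> y) = \<Phi> x \<oplus>\<^bsub>W\<^esub> \<Phi> y"
    and smult: "\<And>r x. r \<in> carrier K \<Longrightarrow> x \<in> carrier X \<Longrightarrow> r \<odot>\<^bsub>X\<^esub> x \<in> carrier X"
      "\<And>r x. r \<in> carrier K \<Longrightarrow> x \<in> carrier X \<Longrightarrow> \<Phi> (r \<odot>\<^bsub>X\<^esub> x) = r \<odot>\<^bsub>W\<^esub> \<Phi> x"
  shows "linear_map K X W \<Phi>"
proof -
  interpret W: Module.module K W using W by (simp add: vectorspace_def)
  have mem: "\<Phi> x \<in> carrier W" if "x \<in> carrier X" for x
    using bij that by (auto simp: bij_betw_def)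
  have inj: "x = y" if "\<Phi> x = \<Phi> y" "x \<in> carrier X" "y \<in> carrier X" for x y
    using bij that by (auto simp: bij_betw_def inj_on_def)
  have "module K X"
  proof (rule module_criteria, goal_cases)
    case 1
    show ?case by (rule W.R.is_cring)
  next
    case 4
    show ?case
    proof
      fix v assume v: "v \<in> carrier X"
      then have "\<ominus>\<^bsub>W\<^esub> \<Phi> v \<in> \<Phi> ` carrier X"
        using bij mem by (simp add: bij_betw_def)
      then obtain w where w: "w \<in> carrier X" "\<Phi> w = \<ominus>\<^bsub>W\<^esub> \<Phi> v" by force
      have "v \<oplus>\<^bsub>X\<^esub> w = \<zero>\<^bsub>X\<^esub>"
        by (rule inj) (simp_all add: add zero v w mem W.M.r_neg)
      with w show "\<exists>neg_v\<in>carrier X. v \<oplus>\<^bsub>X\<^esub> neg_v = \<zero>\<^bsub>X\<^esub>" by blast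
    qed
  qed (auto intro!: inj simp: zero add smult mem W.M.a_ac W.smult_assoc1
      W.smult_l_distr W.smult_r_distr)
  then have "vectorspace K X"
    using W by (simp add: vectorspace_def)
  then show ?thesis
    unfolding linear_map_iff using W mem add(2) smult(2) by blast
qed

lemma vs_isomorphic_trans:
  assumes "vs_isomorphic K U V" "vs_isomorphic K V W"
  shows "vs_isomorphic K U W"
proof -
  obtain S T where S: "linear_map K U V S" "bij_betw S (carrier U) (carrier V)"
    and T: "linear_map K V W T" "bij_betw T (carrier V) (carrier W)"
    using assms unfolding vs_isomorphic_def by blast
  have "linear_map K U W (T \<circ> S)"
    using S(1) T(1) unfolding linear_map_iff by (auto simp: Pi_iff)
  moreover have "bij_betw (T \<circ> S) (carrier U) (carrier W)"
    using S(2) T(2) by (rule bij_betw_trans)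
  ultimately show ?thesis unfolding vs_isomorphic_def by blast
qed

lemma vs_isomorphic_sym:
  assumes "vs_isomorphic K V W"
  shows "vs_isomorphic K W V"
proof -
  obtain T where T: "linear_map K V W T" "bij_betw T (carrier V) (carrier W)"
    using assms unfolding vs_isomorphic_def by blast
  define S where "S = inv_into (carrier V) T"
  have S: "bij_betw S (carrier W) (carrier V)"
    unfolding S_def by (rule bij_betw_inv_into[OF T(2)])
  have TS: "T (S w) = w" "S w \<in> carrier V" if "w \<in> carrier W" for w
    using that T(2) S unfolding S_def
    by (simp_all add: bij_betw_inv_into_right bij_betwE)
  have ST: "S (T v) = v" if "v \<in> carrier V" for v
    using that T(2) unfolding S_def by (simp add: bij_betw_inv_into_left)
  interpret L: linear_map K V W T by fact
  have "S (x \<oplus>\<^bsub>W\<^esub> y) = S x \<oplus>\<^bsub>V\<^esub> S y" if "x \<in> carrier W" "y \<in> carrier W" for x y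
    using ST[of "S x \<oplus>\<^bsub>V\<^esub> S y"] that TS L.T_add by simp
  moreover have "S (r \<odot>\<^bsub>W\<^esub> x) = r \<odot>\<^bsub>V\<^esub> S x" if "r \<in> carrier K" "x \<in> carrier W" for r x
    using ST[of "r \<odot>\<^bsub>V\<^esub> S x"] that TS L.T_smult by simp
  ultimately have "linear_map K W V S"
    using T(1) TS(2) unfolding linear_map_iff by blast
  with S show ?thesis unfolding vs_isomorphic_def by blast
qed

text \<open>The cosets of the kernel are the fibres of the map.\<close>

lemma quotient_module_vs_isomorphic:
  assumes T: "linear_map K V W T" and surj: "T ` carrier V = carrier W"
    and N: "N = {x \<in> carrier V. T x = \<zero>\<^bsub>W\<^esub>}"
  shows "vs_isomorphic K (quotient_module V N) W"
proof -
  interpret VM: Module.module K V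
    using T by (simp add: linear_map_def vectorspace_def)
  interpret WM: Module.module K W
    using T by (simp add: linear_map_def vectorspace_def)
  interpret T: linear_map K V W T by fact
  define fib where "fib w = {x \<in> carrier V. T x = w}" for w
  have Tc: "T x \<in> carrier W" if "x \<in> carrier V" for x
    using surj that by blast
  have fib_ne: "\<exists>x. x \<in> fib w" if "w \<in> carrier W" for w
    using that unfolding fib_def surj[symmetric] by blast
  have coset: "N +>\<^bsub>V\<^esub> x = fib (T x)" if x: "x \<in> carrier V" for x
  proof
    show "N +>\<^bsub>V\<^esub> x \<subseteq> fib (T x)"
      using x by (auto simp: a_r_coset_def' N fib_def Tc)
    show "fib (T x) \<subseteq> N +>\<^bsub>V\<^esub> x"
    proof
      fix y assume y: "y \<in> fib (T x)"
      then have yV: "y \<in> carrier V" "T y = T x" by (auto simp: fib_def)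
      have "y \<ominus>\<^bsub>V\<^esub> x \<in> N"
        using yV x by (simp add: N T.T_minus Tc)
      moreover have "y = (y \<ominus>\<^bsub>V\<^esub> x) \<oplus>\<^bsub>V\<^esub> x"
        using yV x by (simp add: a_minus_def VM.M.a_assoc VM.M.l_neg)
      ultimately show "y \<in> N +>\<^bsub>V\<^esub> x"
        unfolding a_r_coset_def' by blast
    qed
  qed
  let ?Q = "quotient_module V N"
  have "a_rcosets\<^bsub>V\<^esub> N = (\<lambda>x. N +>\<^bsub>V\<^esub> x) ` carrier V"
    unfolding A_RCOSETS_def RCOSETS_def a_r_coset_def by auto
  also have "\<dots> = (\<lambda>x. fib (T x)) ` carrier V"
    using coset by (rule image_cong[OF refl])
  also have "\<dots> = fib ` carrier W"
    using surj by (metis image_image)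
  finally have car: "carrier ?Q = fib ` carrier W"
    by (simp add: quotient_module_def)
  \<comment> \<open>\<open>T\<close> is constant on a fibre, so the choice of representative does
    not matter.\<close>
  define \<Phi> where "\<Phi> X = T (SOME x. x \<in> X)" for X
  have \<Phi>: "\<Phi> (fib w) = w" if "w \<in> carrier W" for w
    using someI_ex[OF fib_ne[OF that]] by (simp add: \<Phi>_def fib_def)
  have add: "fib v \<oplus>\<^bsub>?Q\<^esub> fib w = fib (v \<oplus>\<^bsub>W\<^esub> w)" if vw: "v \<in> carrier W" "w \<in> carrier W" for v w
  proof -
    obtain x where x: "x \<in> carrier V" "T x = v"
      using fib_ne[OF vw(1)] by (auto simp: fib_def)
    \<comment> \<open>A sum of fibres is a whole fibre: fix \<open>x\<close> over \<open>v\<close>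
      and write \<open>z\<close> as \<open>x\<close> plus the difference, which lies over
      \<open>w\<close>.\<close>
    have "\<exists>a\<in>fib v. \<exists>b\<in>fib w. z = a \<oplus>\<^bsub>V\<^esub> b" if z: "z \<in> carrier V" "T z = v \<oplus>\<^bsub>W\<^esub> w" for z
    proof (intro bexI)
      show "z = x \<oplus>\<^bsub>V\<^esub> (z \<ominus>\<^bsub>V\<^esub> x)"
        using x z by (simp add: a_minus_def VM.M.a_lcomm[of x z] VM.M.r_neg)
      show "x \<in> fib v" using x by (simp add: fib_def)
      have "T (z \<ominus>\<^bsub>V\<^esub> x) = (v \<oplus>\<^bsub>W\<^esub> w) \<ominus>\<^bsub>W\<^esub> v"
        using x z by (simp add: T.T_minus)
      also have "\<dots> = w"
        using vw by (simp add: a_minus_def WM.M.a_comm[of v w] WM.M.a_assoc WM.M.r_neg)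
      finally show "z \<ominus>\<^bsub>V\<^esub> x \<in> fib w" using x z by (simp add: fib_def)
    qed
    then have "fib v <+>\<^bsub>V\<^esub> fib w = fib (v \<oplus>\<^bsub>W\<^esub> w)"
      unfolding set_add_def set_mult_def by (fastforce simp: fib_def)
    then show ?thesis by (simp add: quotient_module_def)
  qed
  have smult: "r \<odot>\<^bsub>?Q\<^esub> fib w = fib (r \<odot>\<^bsub>W\<^esub> w)" if r: "r \<in> carrier K" and w: "w \<in> carrier W" for r w
  proof -
    \<comment> \<open>All members of the union defining scalar multiplication are the same coset,
      and the fibre is nonempty, so the union is that coset; this also covers r = 0.\<close>
    have "N +>\<^bsub>V\<^esub> (r \<odot>\<^bsub>V\<^esub> x) = fib (r \<odot>\<^bsub>W\<^esub> w)" if "x \<in> fib w" for x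
      using that r by (simp add: fib_def[of w] coset T.T_smult)
    then have "(\<Union>x\<in>fib w. N +>\<^bsub>V\<^esub> (r \<odot>\<^bsub>V\<^esub> x)) = fib (r \<odot>\<^bsub>W\<^esub> w)"
      using fib_ne[OF w] by blast
    then show ?thesis by (simp add: quotient_module_def)
  qed
  have zero: "\<zero>\<^bsub>?Q\<^esub> = fib \<zero>\<^bsub>W\<^esub>"
    by (simp add: quotient_module_def N fib_def)
  have "inj_on \<Phi> (carrier ?Q)"
    unfolding car by (rule inj_onI) (auto simp: \<Phi>)
  moreover have "\<Phi> ` carrier ?Q = carrier W"
    unfolding car image_image by (simp add: \<Phi>)
  ultimately have bij: "bij_betw \<Phi> (carrier ?Q) (carrier W)"
    by (simp add: bij_betw_def)
  moreover have "linear_map K ?Q W \<Phi>"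
  proof (rule linear_map_transport[OF _ bij])
    show "vectorspace K W" using T by (simp add: linear_map_def)
  qed (auto simp: car zero add smult \<Phi>)
  ultimately show ?thesis unfolding vs_isomorphic_def by blast
qed

section \<open>Function spaces and their direct sums\<close>

abbreviation fun_space :: "'b set \<Rightarrow> (real, 'b \<Rightarrow> real) module" where
  "fun_space B \<equiv> ring.func_space class_ring B"

lemma fun_space_simps [simp]:
  "carrier (fun_space B) = B \<rightarrow>\<^sub>E UNIV"
  "\<zero>\<^bsub>fun_space B\<^esub> = (\<lambda>b\<in>B. 0)"
  "f \<oplus>\<^bsub>fun_space B\<^esub> g = (\<lambda>b\<in>B. f b + g b)"
  "r \<odot>\<^bsub>fun_space B\<^esub> f = (\<lambda>b\<in>B. r * f b)"
  by (simp_all add: ring.func_space_def[OF class_ring.ring_axioms])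

lemma fun_space_vectorspace: "vectorspace class_ring (fun_space B)"
  by (simp add: vectorspace_def class_field cring.func_space_is_module[OF class_cring.cring_axioms])

text \<open>Serves twice: for the finitely supported functions of a free module and for the cocycles
  of one degree.\<close>

lemma fun_space_subspace:
  assumes sub: "Z \<subseteq> B \<rightarrow>\<^sub>E UNIV" and zero: "(\<lambda>b\<in>B. 0) \<in> Z"
    and add: "\<And>f g. f \<in> Z \<Longrightarrow> g \<in> Z \<Longrightarrow> (\<lambda>b\<in>B. f b + g b) \<in> Z"
    and smult: "\<And>r f. f \<in> Z \<Longrightarrow> (\<lambda>b\<in>B. r * f b) \<in> Z"
  shows "vectorspace class_ring ((fun_space B)\<lparr>carrier := Z\<rparr>)"
proof -
  have M: "module class_ring (fun_space B)"
    using fun_space_vectorspace[of B] by (simp add: vectorspace_def)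
  moreover have "LinearCombinations.submodule class_ring Z (fun_space B)"
    unfolding submodule_def using M assms by simp
  ultimately show ?thesis
    by (simp add: vectorspace_def class_field LinearCombinations.module.submodule_is_module)
qed

text \<open>\<open>ind\<close> partitions \<open>B\<close> into the blocks \<open>C i\<close>, and a
  function on \<open>B\<close> is the same as a family of functions on the blocks. As
  \<open>I\<close> is finite, the support condition in the direct sum is automatic.\<close>

lemma direct_sum_family_vs_isomorphic:
  fixes M :: "'i \<Rightarrow> (real, 'm, 'e) module_scheme" and B :: "'a set"
  assumes I: "finite I"
    and M: "\<And>i. i \<in> I \<Longrightarrow> vs_isomorphic class_ring (M i) (fun_space (C i))"
    and C: "\<And>i c. i \<in> I \<Longrightarrow> c \<in> C i \<longleftrightarrow> c \<in> B \<and> ind c = i"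
    and B: "\<And>c. c \<in> B \<Longrightarrow> ind c \<in> I"
  shows "vs_isomorphic class_ring (direct_sum_family I M) (fun_space B)"
proof -
  have "\<forall>i\<in>I. \<exists>T. linear_map class_ring (M i) (fun_space (C i)) T
      \<and> bij_betw T (carrier (M i)) (carrier (fun_space (C i)))"
    using M by (simp add: vs_isomorphic_def)
  then obtain T where T: "\<And>i. i \<in> I \<Longrightarrow> linear_map class_ring (M i) (fun_space (C i)) (T i)"
      "\<And>i. i \<in> I \<Longrightarrow> bij_betw (T i) (carrier (M i)) (C i \<rightarrow>\<^sub>E UNIV)"
    unfolding fun_space_simps by metis
  let ?S = "direct_sum_family I M"
  have car: "carrier ?S = (\<Pi>\<^sub>E i\<in>I. carrier (M i))"
    using I by (simp add: direct_sum_family_def)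
  have Mi: "module class_ring (M i)" if "i \<in> I" for i
    using T(1)[OF that] by (simp add: linear_map_def vectorspace_def)
  define \<Phi> where "\<Phi> x = (\<lambda>c\<in>B. T (ind c) (x (ind c)) c)" for x
  have "bij_betw \<Phi> (carrier ?S) (carrier (fun_space B))"
  proof (rule bij_betwI[where g = "\<lambda>f. \<lambda>i\<in>I. inv_into (carrier (M i)) (T i) (restrict f (C i))"])
    show "\<Phi> \<in> carrier ?S \<rightarrow> carrier (fun_space B)"
      by (simp add: \<Phi>_def)
    show "(\<lambda>f. \<lambda>i\<in>I. inv_into (carrier (M i)) (T i) (restrict f (C i)))
        \<in> carrier (fun_space B) \<rightarrow> carrier ?S"
    proof
      fix f :: "'a \<Rightarrow> real"
      have "inv_into (carrier (M i)) (T i) (restrict f (C i)) \<in> carrier (M i)" if "i \<in> I" for i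
        using bij_betwE[OF bij_betw_inv_into[OF T(2)[OF that]]] by simp
      then show "(\<lambda>i\<in>I. inv_into (carrier (M i)) (T i) (restrict f (C i))) \<in> carrier ?S"
        by (simp add: car)
    qed
  next
    fix x assume x: "x \<in> carrier ?S"
    show "(\<lambda>i\<in>I. inv_into (carrier (M i)) (T i) (restrict (\<Phi> x) (C i))) = x"
    proof
      fix i
      show "(\<lambda>i\<in>I. inv_into (carrier (M i)) (T i) (restrict (\<Phi> x) (C i))) i = x i"
      proof (cases "i \<in> I")
        case True
        then have xi: "x i \<in> carrier (M i)" using x by (auto simp: car)
        then have "T i (x i) \<in> C i \<rightarrow>\<^sub>E UNIV"
          using T(2)[OF True] by (simp add: bij_betwE)
        then have "restrict (\<Phi> x) (C i) = T i (x i)"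
          by (intro ext) (auto simp: \<Phi>_def C[OF True] restrict_def PiE_def extensional_def)
        then show ?thesis using True xi bij_betw_inv_into_left[OF T(2)[OF True]] by simp
      next
        case False
        then show ?thesis using x by (auto simp: car PiE_def extensional_def)
      qed
    qed
  next
    fix f assume f: "f \<in> carrier (fun_space B)"
    show "\<Phi> (\<lambda>i\<in>I. inv_into (carrier (M i)) (T i) (restrict f (C i))) = f"
    proof
      fix c
      show "\<Phi> (\<lambda>i\<in>I. inv_into (carrier (M i)) (T i) (restrict f (C i))) c = f c"
      proof (cases "c \<in> B")
        case True
        note i = B[OF True]
        have "T (ind c) (inv_into (carrier (M (ind c))) (T (ind c)) (restrict f (C (ind c))))
            = restrict f (C (ind c))"
          by (rule bij_betw_inv_into_right[OF T(2)[OF i]]) simp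
        then show ?thesis using True i by (simp add: \<Phi>_def C)
      next
        case False
        then show ?thesis using f by (auto simp: \<Phi>_def PiE_def extensional_def)
      qed
    qed
  qed
  moreover have "linear_map class_ring ?S (fun_space B) \<Phi>"
  proof (rule linear_map_transport[OF fun_space_vectorspace calculation], goal_cases)
    case 1
    show ?case
      using Module.module.axioms(2)[OF Mi]
      by (auto simp: direct_sum_family_def abelian_group_def abelian_monoid.zero_closed)
  next
    case 2
    show ?case
      unfolding \<Phi>_def fun_space_simps
      by (rule restrict_ext) (simp add: direct_sum_family_def B linear_map_zero[OF T(1)] C)
  next
    case (3 x y)
    have "x i \<oplus>\<^bsub>M i\<^esub> y i \<in> carrier (M i)" if "i \<in> I" for i
    proof -
      interpret Module.module class_ring "M i" by (rule Mi[OF that])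
      show ?thesis using 3 that by (auto simp: car)
    qed
    then show ?case unfolding car by (simp add: direct_sum_family_def)
  next
    case (4 x y)
    show ?case unfolding fun_space_simps
    proof
      fix c
      show "\<Phi> (x \<oplus>\<^bsub>?S\<^esub> y) c = (\<lambda>c\<in>B. \<Phi> x c + \<Phi> y c) c"
      proof (cases "c \<in> B")
        case True
        note i = B[OF True]
        have "x (ind c) \<in> carrier (M (ind c))" "y (ind c) \<in> carrier (M (ind c))"
          using 4 i by (auto simp: car)
        then show ?thesis
          using True i T(1)[OF i] by (simp add: \<Phi>_def direct_sum_family_def linear_map_iff C)
      qed (simp add: \<Phi>_def)
    qed
  next
    case (5 r x)
    have "r \<odot>\<^bsub>M i\<^esub> x i \<in> carrier (M i)" if "i \<in> I" for i
    proof -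
      interpret Module.module class_ring "M i" by (rule Mi[OF that])
      show ?thesis using 5 that smult_closed[of r "x i"] by (auto simp: car)
    qed
    then show ?case unfolding car by (simp add: direct_sum_family_def)
  next
    case (6 r x)
    show ?case unfolding fun_space_simps
    proof
      fix c
      show "\<Phi> (r \<odot>\<^bsub>?S\<^esub> x) c = (\<lambda>c\<in>B. r * \<Phi> x c) c"
      proof (cases "c \<in> B")
        case True
        note i = B[OF True]
        have "x (ind c) \<in> carrier (M (ind c))"
          using 6 i by (auto simp: car)
        then show ?thesis
          using True i T(1)[OF i] by (simp add: \<Phi>_def direct_sum_family_def linear_map_iff C)
      qed (simp add: \<Phi>_def)
    qed
  qed
  ultimately show ?thesis unfolding vs_isomorphic_def by blast
qed

section \<open>Tensor products of coordinatized spaces\<close>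

locale coordinates =
  fixes V :: "(real, 'm, 'e) module_scheme" and A :: "'a set" and \<phi> :: "'m \<Rightarrow> 'a \<Rightarrow> real"
  assumes linear: "linear_map class_ring V (fun_space A) \<phi>"
    and bij: "bij_betw \<phi> (carrier V) (A \<rightarrow>\<^sub>E UNIV)"
    and finite_index: "finite A"
begin

sublocale V: Module.module class_ring V
  using linear by (simp add: linear_map_def vectorspace_def)

lemma coord_add: "x \<in> carrier V \<Longrightarrow> y \<in> carrier V \<Longrightarrow> a \<in> A \<Longrightarrow> \<phi> (x \<oplus>\<^bsub>V\<^esub> y) a = \<phi> x a + \<phi> y a"
  using linear by (simp add: linear_map_iff)

lemma coord_smult: "x \<in> carrier V \<Longrightarrow> a \<in> A \<Longrightarrow> \<phi> (r \<odot>\<^bsub>V\<^esub> x) a = r * \<phi> x a"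
  using linear by (simp add: linear_map_iff)

lemma coord_eqI:
  assumes "x \<in> carrier V" "y \<in> carrier V" "\<And>a. a \<in> A \<Longrightarrow> \<phi> x a = \<phi> y a"
  shows "x = y"
proof -
  have "\<phi> x \<in> A \<rightarrow>\<^sub>E UNIV" "\<phi> y \<in> A \<rightarrow>\<^sub>E UNIV"
    using assms bij by (auto dest: bij_betwE)
  then have "\<phi> x = \<phi> y"
    using assms(3) by (intro PiE_ext) auto
  then show ?thesis
    using bij assms by (auto simp: bij_betw_def inj_on_def)
qed

definition basis_vector :: "'a \<Rightarrow> 'm" where
  "basis_vector a = inv_into (carrier V) \<phi> (\<lambda>b\<in>A. of_bool (b = a))"

lemma basis_vector_closed: "basis_vector a \<in> carrier V"
  using bij_betw_inv_into[OF bij] unfolding basis_vector_def by (auto dest: bij_betwE)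

lemma coord_basis_vector: "b \<in> A \<Longrightarrow> \<phi> (basis_vector a) b = of_bool (b = a)"
  using bij_betw_inv_into_right[OF bij, of "\<lambda>b\<in>A. of_bool (b = a)"]
  by (simp add: basis_vector_def)

text \<open>\<open>U\<close> plays the role of a subspace and \<open>g\<close> is linear only modulo
  \<open>U\<close>. It is applied to free generators, which become additive and homogeneous only
  modulo the tensor relations. The coordinates of \<open>x\<close> are cleared one at a
  time.\<close>

lemma basis_expansion_modulo:
  fixes g :: "'m \<Rightarrow> 's \<Rightarrow> real"
  assumes U_add: "\<And>f f'. U f \<Longrightarrow> U f' \<Longrightarrow> U (\<lambda>s. f s + f' s)"
    and U_scale: "\<And>f r. U f \<Longrightarrow> U (\<lambda>s. r * f s)"
    and g_add: "\<And>x y. x \<in> carrier V \<Longrightarrow> y \<in> carrier V \<Longrightarrow> U (\<lambda>s. g (x \<oplus>\<^bsub>V\<^esub> y) s - (g x s + g y s))"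
    and g_smult: "\<And>r x. x \<in> carrier V \<Longrightarrow> U (\<lambda>s. g (r \<odot>\<^bsub>V\<^esub> x) s - r * g x s)"
    and x: "x \<in> carrier V"
  shows "U (\<lambda>s. g x s - (\<Sum>a\<in>A. \<phi> x a * g (basis_vector a) s))"
proof -
  have "U (\<lambda>s. g x s - (\<Sum>a\<in>A0. \<phi> x a * g (basis_vector a) s))"
    if "finite A0" "A0 \<subseteq> A" "x \<in> carrier V" "\<And>a. a \<in> A - A0 \<Longrightarrow> \<phi> x a = 0" for A0 x
    using that
  proof (induction A0 arbitrary: x rule: finite_induct)
    case empty
    \<comment> \<open>All coordinates vanish, so \<open>x\<close> is its own multiple by 0;
      homogeneity modulo \<open>U\<close> with factor 0 then puts \<open>g x\<close> itself into
      \<open>U\<close>.\<close>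
    have "x = 0 \<odot>\<^bsub>V\<^esub> x"
      by (rule coord_eqI) (use empty V.smult_closed[of 0 x] coord_smult[of x] in auto)
    then show ?case using g_smult[of x 0] empty by simp
  next
    case (insert a A0)
    let ?b = "\<phi> x a \<odot>\<^bsub>V\<^esub> basis_vector a"
    \<comment> \<open>\<open>x\<close> with its coordinate at \<open>a\<close> cleared.\<close>
    let ?y = "x \<oplus>\<^bsub>V\<^esub> (- \<phi> x a) \<odot>\<^bsub>V\<^esub> basis_vector a"
    have closed: "r \<odot>\<^bsub>V\<^esub> basis_vector a \<in> carrier V" for r
      using V.smult_closed[of r] basis_vector_closed by simp
    have y: "?y \<in> carrier V"
      using closed insert.prems by simp
    have coord_y: "\<phi> ?y c = \<phi> x c - \<phi> x a * of_bool (c = a)" if "c \<in> A" for c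
      using that closed insert.prems basis_vector_closed
      by (simp add: coord_add coord_smult coord_basis_vector)
    have "U (\<lambda>s. g ?y s - (\<Sum>c\<in>A0. \<phi> ?y c * g (basis_vector c) s))"
      by (rule insert.IH[OF _ y]) (use insert.prems coord_y in auto)
    moreover have "(\<Sum>c\<in>A0. \<phi> ?y c * g (basis_vector c) s) = (\<Sum>c\<in>A0. \<phi> x c * g (basis_vector c) s)"
      for s
      by (rule sum.cong[OF refl], subst coord_y) (use insert in auto)
    moreover have x_eq: "x = ?y \<oplus>\<^bsub>V\<^esub> ?b"
      by (rule coord_eqI)
        (use insert.prems closed y basis_vector_closed in
          \<open>simp_all add: coord_add coord_smult coord_basis_vector coord_y\<close>)
    have "U (\<lambda>s. g x s - (g ?y s + g ?b s))"
      by (rule g_add[OF y closed[of "\<phi> x a"], folded x_eq])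
    moreover have "U (\<lambda>s. g ?b s - \<phi> x a * g (basis_vector a) s)"
      by (rule g_smult[OF basis_vector_closed])
    ultimately have "U (\<lambda>s. (g x s - (g ?y s + g ?b s)) +
       ((g ?y s - (\<Sum>c\<in>A0. \<phi> x c * g (basis_vector c) s)) +
       (g ?b s - \<phi> x a * g (basis_vector a) s)))"
      by (intro U_add) simp_all
    moreover have "(\<lambda>s. (g x s - (g ?y s + g ?b s)) +
       ((g ?y s - (\<Sum>c\<in>A0. \<phi> x c * g (basis_vector c) s)) +
       (g ?b s - \<phi> x a * g (basis_vector a) s)))
      = (\<lambda>s. g x s - (\<Sum>c\<in>insert a A0. \<phi> x c * g (basis_vector c) s))"
      using insert.hyps by (intro ext) simp
    ultimately show ?case by simp
  qed
  from this[OF finite_index order.refl x] show ?thesis by simp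
qed

end

section \<open>The tensor product as a quotient of the free module\<close>

locale tensor_coordinates = L: coordinates V A \<phi> + R: coordinates W B \<psi>
  for V :: "(real, 'm, 'e) module_scheme" and A :: "'a set" and \<phi>
    and W :: "(real, 'n, 'f) module_scheme" and B :: "'b set" and \<psi>
begin

abbreviation "S \<equiv> carrier V \<times> carrier W"

abbreviation "F \<equiv> free_module class_ring S :: (real, 'm \<times> 'n \<Rightarrow> real) module"

definition supp :: "('m \<times> 'n \<Rightarrow> real) \<Rightarrow> ('m \<times> 'n) set" where
  "supp f = {s \<in> S. f s \<noteq> 0}"

lemma free_simps [simp]:
  "f \<in> carrier F \<longleftrightarrow> f \<in> S \<rightarrow>\<^sub>E UNIV \<and> finite (supp f)"
  "\<zero>\<^bsub>F\<^esub> = (\<lambda>s\<in>S. 0)"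
  "f \<oplus>\<^bsub>F\<^esub> g = (\<lambda>s\<in>S. f s + g s)"
  "r \<odot>\<^bsub>F\<^esub> f = (\<lambda>s\<in>S. r * f s)"
  by (simp_all add: free_module_def supp_def ring.func_space_def[OF class_ring.ring_axioms])

lemma supp_add: "supp (\<lambda>s\<in>S. f s + g s) \<subseteq> supp f \<union> supp g"
  by (auto simp: supp_def)

lemma supp_smult: "supp (\<lambda>s\<in>S. r * f s) \<subseteq> supp f"
  by (auto simp: supp_def)

lemma free_vectorspace: "vectorspace class_ring F"
proof -
  have "vectorspace class_ring ((fun_space S)\<lparr>carrier := {f \<in> S \<rightarrow>\<^sub>E UNIV. finite (supp f)}\<rparr>)"
  proof (rule fun_space_subspace)
    show "(\<lambda>s\<in>S. 0) \<in> {f \<in> S \<rightarrow>\<^sub>E UNIV. finite (supp f)}"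
      by (simp add: supp_def)
  qed (auto intro: finite_subset[OF supp_add] finite_subset[OF supp_smult])
  then show ?thesis
    by (simp add: free_module_def supp_def ring.func_space_def[OF class_ring.ring_axioms])
qed

sublocale F: Module.module class_ring F
  using free_vectorspace by (simp add: vectorspace_def)

text \<open>The free generator before restriction to \<open>S\<close>; it allows ordinary pointwise
  arithmetic in place of the restricted operations of \<open>F\<close>.\<close>

definition delta :: "'m \<times> 'n \<Rightarrow> 'm \<times> 'n \<Rightarrow> real" where
  "delta p = (\<lambda>s. of_bool (s = p))"

lemma free_gen_eq: "free_gen class_ring S p = restrict (delta p) S"
  by (auto simp: free_gen_def delta_def)

lemma free_gen_closed: "free_gen class_ring S p \<in> carrier F"
proof -
  have "supp (restrict (delta p) S) \<subseteq> {p}"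
    by (auto simp: supp_def delta_def)
  then show ?thesis by (auto simp: free_gen_eq intro: finite_subset)
qed

lemma free_minus:
  assumes "f \<in> carrier F" "g \<in> carrier F"
  shows "f \<ominus>\<^bsub>F\<^esub> g = (\<lambda>s\<in>S. f s - g s)"
proof -
  have "\<ominus>\<^bsub>F\<^esub> g = (-1) \<odot>\<^bsub>F\<^esub> g"
    using F.smult_minus_1[OF assms(2)] by (simp add: class_ring_simps)
  then show ?thesis by (auto simp: a_minus_def)
qed

text \<open>The linear extension of the bilinear map sending (x, y) to its matrix of coordinate
  products. It is the map whose kernel is to be the span of the tensor relations.\<close>

definition eval :: "('m \<times> 'n \<Rightarrow> real) \<Rightarrow> 'a \<times> 'b \<Rightarrow> real" where
  "eval f = (\<lambda>(a, b)\<in>A \<times> B. \<Sum>s\<in>supp f. f s * (\<phi> (fst s) a * \<psi> (snd s) b))"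

lemma eval_eq:
  assumes "finite X" "supp f \<subseteq> X" "X \<subseteq> S" "a \<in> A" "b \<in> B"
  shows "eval f (a, b) = (\<Sum>s\<in>X. f s * (\<phi> (fst s) a * \<psi> (snd s) b))"
proof -
  have "(\<Sum>s\<in>supp f. f s * (\<phi> (fst s) a * \<psi> (snd s) b))
      = (\<Sum>s\<in>X. f s * (\<phi> (fst s) a * \<psi> (snd s) b))"
    by (rule sum.mono_neutral_left) (use assms in \<open>auto simp: supp_def\<close>)
  then show ?thesis using assms by (simp add: eval_def)
qed

lemma supp_subset: "supp f \<subseteq> S"
  by (auto simp: supp_def)

lemma eval_linear: "linear_map class_ring F (fun_space (A \<times> B)) eval"
  unfolding linear_map_iff
proof (intro conjI ballI free_vectorspace fun_space_vectorspace)
  show "eval \<in> carrier F \<rightarrow> carrier (fun_space (A \<times> B))"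
    by (simp add: eval_def)
next
  fix f g assume fg: "f \<in> carrier F" "g \<in> carrier F"
  show "eval (f \<oplus>\<^bsub>F\<^esub> g) = eval f \<oplus>\<^bsub>fun_space (A \<times> B)\<^esub> eval g"
  proof
    fix ab
    show "eval (f \<oplus>\<^bsub>F\<^esub> g) ab = (eval f \<oplus>\<^bsub>fun_space (A \<times> B)\<^esub> eval g) ab"
    proof (cases "ab \<in> A \<times> B")
      case True
      then obtain a b where ab: "ab = (a, b)" "a \<in> A" "b \<in> B" by blast
      let ?X = "supp f \<union> supp g"
      have X: "finite ?X" "?X \<subseteq> S" using fg supp_subset by auto
      have "eval (f \<oplus>\<^bsub>F\<^esub> g) (a, b)
          = (\<Sum>s\<in>?X. (\<lambda>s\<in>S. f s + g s) s * (\<phi> (fst s) a * \<psi> (snd s) b))"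
        unfolding free_simps by (rule eval_eq[OF X(1) supp_add X(2) ab(2,3)])
      also have "\<dots> = (\<Sum>s\<in>?X. f s * (\<phi> (fst s) a * \<psi> (snd s) b)
          + g s * (\<phi> (fst s) a * \<psi> (snd s) b))"
        by (rule sum.cong[OF refl]) (use X(2) in \<open>auto simp: distrib_right\<close>)
      also have "\<dots> = eval f (a, b) + eval g (a, b)"
        using eval_eq[OF X(1) _ X(2) ab(2,3), of f] eval_eq[OF X(1) _ X(2) ab(2,3), of g]
        by (simp add: sum.distrib)
      finally show ?thesis using ab by simp
    qed (simp add: eval_def)
  qed
next
  fix r f assume f: "f \<in> carrier F"
  show "eval (r \<odot>\<^bsub>F\<^esub> f) = r \<odot>\<^bsub>fun_space (A \<times> B)\<^esub> eval f"
  proof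
    fix ab
    show "eval (r \<odot>\<^bsub>F\<^esub> f) ab = (r \<odot>\<^bsub>fun_space (A \<times> B)\<^esub> eval f) ab"
    proof (cases "ab \<in> A \<times> B")
      case True
      then obtain a b where ab: "ab = (a, b)" "a \<in> A" "b \<in> B" by blast
      have X: "finite (supp f)" using f by simp
      have "eval (r \<odot>\<^bsub>F\<^esub> f) (a, b)
          = (\<Sum>s\<in>supp f. (\<lambda>s\<in>S. r * f s) s * (\<phi> (fst s) a * \<psi> (snd s) b))"
        unfolding free_simps by (rule eval_eq[OF X supp_smult supp_subset ab(2,3)])
      also have "\<dots> = (\<Sum>s\<in>supp f. r * (f s * (\<phi> (fst s) a * \<psi> (snd s) b)))"
        by (rule sum.cong[OF refl]) (auto simp: supp_def)
      also have "\<dots> = r * eval f (a, b)"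
        using ab by (simp add: eval_def sum_distrib_left)
      finally show ?thesis using ab by simp
    qed (simp add: eval_def)
  qed
qed

lemma eval_free_gen:
  assumes "x \<in> carrier V" "y \<in> carrier W"
  shows "eval (free_gen class_ring S (x, y)) = (\<lambda>(a, b)\<in>A \<times> B. \<phi> x a * \<psi> y b)"
proof
  fix ab
  show "eval (free_gen class_ring S (x, y)) ab = (\<lambda>(a, b)\<in>A \<times> B. \<phi> x a * \<psi> y b) ab"
  proof (cases "ab \<in> A \<times> B")
    case True
    then obtain a b where ab: "ab = (a, b)" "a \<in> A" "b \<in> B" by blast
    have "eval (free_gen class_ring S (x, y)) (a, b)
        = (\<Sum>s\<in>{(x, y)}. free_gen class_ring S (x, y) s * (\<phi> (fst s) a * \<psi> (snd s) b))"
      by (rule eval_eq) (use assms ab in \<open>auto simp: supp_def free_gen_eq delta_def\<close>)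
    then show ?thesis using ab assms by (simp add: free_gen_eq delta_def)
  qed (simp add: eval_def)
qed

abbreviation "rels \<equiv> tensor_relations class_ring V W"

abbreviation "e x y \<equiv> free_gen class_ring S (x, y)"

lemma rels_cases:
  assumes "f \<in> rels"
  obtains (add_left) x x' y where "x \<in> carrier V" "x' \<in> carrier V" "y \<in> carrier W"
      "f = e (x \<oplus>\<^bsub>V\<^esub> x') y \<ominus>\<^bsub>F\<^esub> (e x y \<oplus>\<^bsub>F\<^esub> e x' y)"
    | (add_right) x y y' where "x \<in> carrier V" "y \<in> carrier W" "y' \<in> carrier W"
      "f = e x (y \<oplus>\<^bsub>W\<^esub> y') \<ominus>\<^bsub>F\<^esub> (e x y \<oplus>\<^bsub>F\<^esub> e x y')"
    | (smult_left) r x y where "x \<in> carrier V" "y \<in> carrier W"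
      "f = e (r \<odot>\<^bsub>V\<^esub> x) y \<ominus>\<^bsub>F\<^esub> (r \<odot>\<^bsub>F\<^esub> e x y)"
    | (smult_right) r x y where "x \<in> carrier V" "y \<in> carrier W"
      "f = e x (r \<odot>\<^bsub>W\<^esub> y) \<ominus>\<^bsub>F\<^esub> (r \<odot>\<^bsub>F\<^esub> e x y)"
  using assms unfolding tensor_relations_def Let_def Un_iff mem_Collect_eq
  by (elim disjE exE conjE)
    (erule (3) add_left | erule (3) add_right | erule (2) smult_left | erule (2) smult_right)+

lemma rels_intros:
  "\<lbrakk>x \<in> carrier V; x' \<in> carrier V; y \<in> carrier W\<rbrakk> \<Longrightarrow>
    e (x \<oplus>\<^bsub>V\<^esub> x') y \<ominus>\<^bsub>F\<^esub> (e x y \<oplus>\<^bsub>F\<^esub> e x' y) \<in> rels"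
  "\<lbrakk>x \<in> carrier V; y \<in> carrier W; y' \<in> carrier W\<rbrakk> \<Longrightarrow>
    e x (y \<oplus>\<^bsub>W\<^esub> y') \<ominus>\<^bsub>F\<^esub> (e x y \<oplus>\<^bsub>F\<^esub> e x y') \<in> rels"
  "\<lbrakk>x \<in> carrier V; y \<in> carrier W\<rbrakk> \<Longrightarrow>
    e (r \<odot>\<^bsub>V\<^esub> x) y \<ominus>\<^bsub>F\<^esub> (r \<odot>\<^bsub>F\<^esub> e x y) \<in> rels"
  "\<lbrakk>x \<in> carrier V; y \<in> carrier W\<rbrakk> \<Longrightarrow>
    e x (r \<odot>\<^bsub>W\<^esub> y) \<ominus>\<^bsub>F\<^esub> (r \<odot>\<^bsub>F\<^esub> e x y) \<in> rels"
  unfolding tensor_relations_def Let_def class_ring_simps by blast+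

abbreviation "ker \<equiv> {f \<in> carrier F. eval f = \<zero>\<^bsub>fun_space (A \<times> B)\<^esub>}"

text \<open>Coordinate products are bilinear, so \<open>eval\<close> takes the two sides of every
  relation to the same function.\<close>

lemma rels_subset: "rels \<subseteq> ker"
proof
  interpret FS: Module.module class_ring "fun_space (A \<times> B)"
    using fun_space_vectorspace[of "A \<times> B"] by (simp add: vectorspace_def)
  interpret E: linear_map class_ring F "fun_space (A \<times> B)" eval by (rule eval_linear)
  have add_closed: "f \<oplus>\<^bsub>F\<^esub> g \<in> carrier F" if "f \<in> carrier F" "g \<in> carrier F" for f g
    using that by (rule F.M.a_closed)
  have smult_closed: "r \<odot>\<^bsub>F\<^esub> f \<in> carrier F" if "f \<in> carrier F" for r f
    using F.smult_closed[of r f] that by simp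
  have minus: "f \<ominus>\<^bsub>F\<^esub> g \<in> ker"
    if "f \<in> carrier F" "g \<in> carrier F" "eval f = eval g" for f g
  proof -
    have "f \<ominus>\<^bsub>F\<^esub> g \<in> carrier F"
      using that(1,2) by (rule F.M.minus_closed)
    moreover have "eval (f \<ominus>\<^bsub>F\<^esub> g) = eval g \<ominus>\<^bsub>fun_space (A \<times> B)\<^esub> eval g"
      using E.T_minus[OF that(1,2)] that(3) by simp
    moreover have "eval g \<in> carrier (fun_space (A \<times> B))"
      by (simp add: eval_def)
    ultimately show ?thesis
      by (simp del: free_simps fun_space_simps add: a_minus_def FS.M.r_neg)
  qed
  note eval_add = E.T_add[OF free_gen_closed free_gen_closed]
  have eval_smult: "eval (r \<odot>\<^bsub>F\<^esub> e x y) = r \<odot>\<^bsub>fun_space (A \<times> B)\<^esub> eval (e x y)" for r x y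
    using E.T_smult[OF _ free_gen_closed, of r] by simp
  fix f assume "f \<in> rels"
  then show "f \<in> ker"
  proof (cases rule: rels_cases)
    case (add_left x x' y)
    have "eval (e (x \<oplus>\<^bsub>V\<^esub> x') y) = eval (e x y \<oplus>\<^bsub>F\<^esub> e x' y)"
      unfolding eval_add using add_left
      by (auto simp: eval_free_gen L.coord_add distrib_right restrict_def)
    then show ?thesis
      unfolding add_left(4) by (intro minus add_closed free_gen_closed)
  next
    case (add_right x y y')
    have "eval (e x (y \<oplus>\<^bsub>W\<^esub> y')) = eval (e x y \<oplus>\<^bsub>F\<^esub> e x y')"
      unfolding eval_add using add_right
      by (auto simp: eval_free_gen R.coord_add distrib_left restrict_def)
    then show ?thesis
      unfolding add_right(4) by (intro minus add_closed free_gen_closed)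
  next
    case (smult_left r x y)
    have "r \<odot>\<^bsub>V\<^esub> x \<in> carrier V"
      using L.V.smult_closed[of r x] smult_left by simp
    then have "eval (e (r \<odot>\<^bsub>V\<^esub> x) y) = eval (r \<odot>\<^bsub>F\<^esub> e x y)"
      unfolding eval_smult using smult_left
      by (auto simp: eval_free_gen L.coord_smult mult.assoc restrict_def)
    then show ?thesis
      unfolding smult_left(3) by (intro minus smult_closed free_gen_closed)
  next
    case (smult_right r x y)
    have "r \<odot>\<^bsub>W\<^esub> y \<in> carrier W"
      using R.V.smult_closed[of r y] smult_right by simp
    then have "eval (e x (r \<odot>\<^bsub>W\<^esub> y)) = eval (r \<odot>\<^bsub>F\<^esub> e x y)"
      unfolding eval_smult using smult_right
      by (auto simp: eval_free_gen R.coord_smult mult.left_commute restrict_def)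
    then show ?thesis
      unfolding smult_right(3) by (intro minus smult_closed free_gen_closed)
  qed
qed

text \<open>Being zero in the tensor product, phrased for unrestricted functions so that pointwise
  sums can be used.\<close>

definition "null f \<longleftrightarrow> restrict f S \<in> F.span rels"

lemma rels_closed: "rels \<subseteq> carrier F"
  using rels_subset by blast

lemma span_submodule: "LinearCombinations.submodule class_ring (F.span rels) F"
  by (rule F.span_is_submodule[OF rels_closed])

lemma null_add: "null f \<Longrightarrow> null g \<Longrightarrow> null (\<lambda>s. f s + g s)"
proof -
  assume "null f" "null g"
  then have "restrict f S \<oplus>\<^bsub>F\<^esub> restrict g S \<in> F.span rels"
    unfolding null_def by (rule LinearCombinations.submodule.m_closed[OF span_submodule])
  moreover have "restrict f S \<oplus>\<^bsub>F\<^esub> restrict g S = restrict (\<lambda>s. f s + g s) S"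
    unfolding free_simps by (rule restrict_ext) simp
  ultimately show ?thesis by (simp add: null_def)
qed

lemma null_scale: "null f \<Longrightarrow> null (\<lambda>s. r * f s)"
proof -
  assume "null f"
  then have "r \<odot>\<^bsub>F\<^esub> restrict f S \<in> F.span rels"
    using LinearCombinations.submodule.smult_closed[OF span_submodule, of r "restrict f S"]
    by (simp add: null_def del: free_simps)
  moreover have "r \<odot>\<^bsub>F\<^esub> restrict f S = restrict (\<lambda>s. r * f s) S"
    unfolding free_simps by (rule restrict_ext) simp
  ultimately show ?thesis by (simp add: null_def)
qed

lemma null_zero: "null (\<lambda>s. 0)"
  using LinearCombinations.submodule.zero_closed[OF span_submodule] by (simp add: null_def)

lemma null_sum: "finite I \<Longrightarrow> (\<And>i. i \<in> I \<Longrightarrow> null (f i)) \<Longrightarrow> null (\<lambda>s. \<Sum>i\<in>I. f i s)"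
  by (induction I rule: finite_induct) (auto simp: null_zero intro: null_add)

lemma null_rel:
  assumes "f \<ominus>\<^bsub>F\<^esub> g \<in> rels" "f \<in> carrier F" "g \<in> carrier F"
    and "\<And>s. s \<in> S \<Longrightarrow> u s = f s - g s"
  shows "null u"
proof -
  have "restrict u S = f \<ominus>\<^bsub>F\<^esub> g"
    unfolding free_minus[OF assms(2,3)] by (rule restrict_ext) (rule assms(4))
  then show ?thesis
    using F.in_own_span[OF rels_closed] assms(1) by (auto simp: null_def)
qed

lemma free_closed:
  "e x y \<oplus>\<^bsub>F\<^esub> e x' y' \<in> carrier F" "r \<odot>\<^bsub>F\<^esub> e x y \<in> carrier F"
  using F.M.a_closed[OF free_gen_closed free_gen_closed] F.smult_closed[OF _ free_gen_closed, of r]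
  by simp_all

lemma null_delta_expansion:
  assumes x: "x \<in> carrier V" and y: "y \<in> carrier W"
  shows "null (\<lambda>s. delta (x, y) s - (\<Sum>a\<in>A. \<Sum>b\<in>B.
    \<phi> x a * \<psi> y b * delta (L.basis_vector a, R.basis_vector b) s))"
proof -
  have 1: "null (\<lambda>s. delta (x, y) s - (\<Sum>a\<in>A. \<phi> x a * delta (L.basis_vector a, y) s))"
  proof (rule L.basis_expansion_modulo[where U = null and g = "\<lambda>x. delta (x, y)",
        OF null_add null_scale _ _ x])
    fix x x' assume x: "x \<in> carrier V" "x' \<in> carrier V"
    show "null (\<lambda>s. delta (x \<oplus>\<^bsub>V\<^esub> x', y) s - (delta (x, y) s + delta (x', y) s))"
      by (rule null_rel[OF rels_intros(1)[OF x y] free_gen_closed free_closed(1)])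
        (simp add: free_gen_eq)
  next
    fix r x assume x: "x \<in> carrier V"
    show "null (\<lambda>s. delta (r \<odot>\<^bsub>V\<^esub> x, y) s - r * delta (x, y) s)"
      by (rule null_rel[OF rels_intros(3)[OF x y] free_gen_closed free_closed(2)])
        (simp add: free_gen_eq)
  qed
  have 2: "null (\<lambda>s. delta (z, y) s - (\<Sum>b\<in>B. \<psi> y b * delta (z, R.basis_vector b) s))"
    if z: "z \<in> carrier V" for z
  proof (rule R.basis_expansion_modulo[where U = null and g = "\<lambda>y. delta (z, y)",
        OF null_add null_scale _ _ y])
    fix y y' assume y: "y \<in> carrier W" "y' \<in> carrier W"
    show "null (\<lambda>s. delta (z, y \<oplus>\<^bsub>W\<^esub> y') s - (delta (z, y) s + delta (z, y') s))"
      by (rule null_rel[OF rels_intros(2)[OF z y] free_gen_closed free_closed(1)])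
        (simp add: free_gen_eq)
  next
    fix r y assume y: "y \<in> carrier W"
    show "null (\<lambda>s. delta (z, r \<odot>\<^bsub>W\<^esub> y) s - r * delta (z, y) s)"
      by (rule null_rel[OF rels_intros(4)[OF z y] free_gen_closed free_closed(2)])
        (simp add: free_gen_eq)
  qed
  \<comment> \<open>First \<open>x\<close> is expanded with \<open>y\<close> fixed, then
    \<open>y\<close> at each basis vector; the intermediate terms telescope.\<close>
  have "null (\<lambda>s. (delta (x, y) s - (\<Sum>a\<in>A. \<phi> x a * delta (L.basis_vector a, y) s)) +
      (\<Sum>a\<in>A. \<phi> x a * (delta (L.basis_vector a, y) s
        - (\<Sum>b\<in>B. \<psi> y b * delta (L.basis_vector a, R.basis_vector b) s))))"
    by (intro null_add 1 null_sum null_scale 2 L.finite_index L.basis_vector_closed)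
  then show ?thesis
    by (simp add: right_diff_distrib sum_subtractf sum_distrib_left mult.assoc)
qed

text \<open>For the harder inclusion: modulo the relations, \<open>f\<close> is the combination of
  the generators at pairs of basis vectors with coefficients \<open>eval f (a, b)\<close>, and these
  vanish on the kernel.\<close>

lemma span_rels_eq: "F.span rels = ker"
proof
  interpret E: linear_map class_ring F "fun_space (A \<times> B)" eval by (rule eval_linear)
  have "LinearCombinations.submodule class_ring ker F"
    using E.ker_is_submodule by (simp only: E.ker_def)
  then show "F.span rels \<subseteq> ker"
    by (rule F.span_is_subset[OF rels_subset])
  show "ker \<subseteq> F.span rels"
  proof
    fix f assume f: "f \<in> ker"
    let ?d = "\<lambda>a b. delta (L.basis_vector a, R.basis_vector b)"
    \<comment> \<open>The weighted sum of the null expansions of the generators in \<open>f\<close>: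
      it is null by construction and equals \<open>f\<close> minus a combination with coefficients
      \<open>eval f\<close>, hence \<open>f\<close>.\<close>
    define u where "u s = (\<Sum>p\<in>supp f. f p * (delta (fst p, snd p) s - (\<Sum>a\<in>A. \<Sum>b\<in>B.
      \<phi> (fst p) a * \<psi> (snd p) b * ?d a b s)))" for s
    have fin: "finite (supp f)" using f by simp
    have "null u"
      unfolding u_def by (intro null_sum fin null_scale null_delta_expansion) (auto simp: supp_def)
    moreover have "restrict u S = f"
    proof
      fix s
      show "restrict u S s = f s"
      proof (cases "s \<in> S")
        case True
        have "(\<Sum>p\<in>supp f. f p * delta (fst p, snd p) s) = (\<Sum>p\<in>supp f. if p = s then f s else 0)"
          by (rule sum.cong) (auto simp: delta_def)
        also have "\<dots> = f s"
          using fin True by (auto simp: supp_def)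
        finally have 1: "(\<Sum>p\<in>supp f. f p * delta (fst p, snd p) s) = f s" .
        have "(\<Sum>p\<in>supp f. f p * (\<Sum>a\<in>A. \<Sum>b\<in>B. \<phi> (fst p) a * \<psi> (snd p) b * ?d a b s))
            = (\<Sum>p\<in>supp f. \<Sum>a\<in>A. \<Sum>b\<in>B. f p * (\<phi> (fst p) a * \<psi> (snd p) b) * ?d a b s)"
          by (simp add: sum_distrib_left mult.assoc)
        also have "\<dots> = (\<Sum>a\<in>A. \<Sum>p\<in>supp f. \<Sum>b\<in>B. f p * (\<phi> (fst p) a * \<psi> (snd p) b) * ?d a b s)"
          by (rule sum.swap)
        also have "\<dots> = (\<Sum>a\<in>A. \<Sum>b\<in>B. \<Sum>p\<in>supp f. f p * (\<phi> (fst p) a * \<psi> (snd p) b) * ?d a b s)"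
          by (intro sum.cong refl sum.swap)
        also have "\<dots> = (\<Sum>a\<in>A. \<Sum>b\<in>B. eval f (a, b) * ?d a b s)"
          by (intro sum.cong refl) (simp add: eval_def sum_distrib_right)
        also have "\<dots> = 0"
          using f by (intro sum.neutral ballI) simp
        finally show ?thesis
          using 1 True by (simp add: u_def right_diff_distrib sum_subtractf)
      next
        case False
        have "f \<in> S \<rightarrow>\<^sub>E UNIV" using f by simp
        from PiE_arb[OF this False] False show ?thesis by (simp add: restrict_def)
      qed
    qed
    ultimately show "f \<in> F.span rels" by (simp add: null_def)
  qed
qed

lemma eval_surj: "eval ` carrier F = carrier (fun_space (A \<times> B))"
proof
  show "eval ` carrier F \<subseteq> carrier (fun_space (A \<times> B))"
    unfolding eval_def fun_space_simps by (intro image_subsetI restrict_PiE[THEN iffD2]) simp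
  show "carrier (fun_space (A \<times> B)) \<subseteq> eval ` carrier F"
  proof
    fix c assume c: "c \<in> carrier (fun_space (A \<times> B))"
    let ?v = "\<lambda>(a, b). (L.basis_vector a, R.basis_vector b)"
    let ?X = "?v ` (A \<times> B)"
    \<comment> \<open>The preimage puts the weight \<open>c (a, b)\<close> on the pair of basis
      vectors, whose coordinate products are 1 at (a, b) and 0 elsewhere.\<close>
    define f where "f = (\<lambda>s\<in>S. \<Sum>p\<in>A \<times> B. c p * delta (?v p) s)"
    have X: "finite ?X" "?X \<subseteq> S"
      using L.finite_index R.finite_index L.basis_vector_closed R.basis_vector_closed by auto
    have supp: "supp f \<subseteq> ?X"
    proof
      fix s assume "s \<in> supp f"
      then have "(\<Sum>p\<in>A \<times> B. c p * delta (?v p) s) \<noteq> 0"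
        by (auto simp: supp_def f_def)
      then obtain p where "p \<in> A \<times> B" "c p * delta (?v p) s \<noteq> 0"
        by (rule sum.not_neutral_contains_not_neutral)
      then show "s \<in> ?X" by (auto simp: delta_def)
    qed
    have "f \<in> carrier F"
      using finite_subset[OF supp X(1)] by (simp add: f_def)
    moreover have "eval f = c"
    proof
      fix ab
      show "eval f ab = c ab"
      proof (cases "ab \<in> A \<times> B")
        case True
        then obtain a b where ab: "ab = (a, b)" "a \<in> A" "b \<in> B" by blast
        let ?w = "\<lambda>s. \<phi> (fst s) a * \<psi> (snd s) b"
        have "eval f (a, b) = (\<Sum>s\<in>?X. f s * ?w s)"
          by (rule eval_eq[OF X(1) supp X(2) ab(2,3)])
        also have "\<dots> = (\<Sum>s\<in>?X. \<Sum>p\<in>A \<times> B. c p * delta (?v p) s * ?w s)"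
          by (rule sum.cong[OF refl]) (use X(2) in \<open>auto simp: f_def sum_distrib_right\<close>)
        also have "\<dots> = (\<Sum>p\<in>A \<times> B. \<Sum>s\<in>?X. c p * delta (?v p) s * ?w s)"
          by (rule sum.swap)
        also have "\<dots> = (\<Sum>p\<in>A \<times> B. if p = (a, b) then c p else 0)"
        proof (rule sum.cong[OF refl])
          fix p assume p: "p \<in> A \<times> B"
          have "(\<Sum>s\<in>?X. c p * delta (?v p) s * ?w s) = (\<Sum>s\<in>?X. if s = ?v p then c p * ?w (?v p) else 0)"
            by (rule sum.cong) (auto simp: delta_def)
          also have "\<dots> = c p * ?w (?v p)"
            using X(1) p by simp
          also have "\<dots> = (if p = (a, b) then c p else 0)"
            using p ab by (auto simp: L.coord_basis_vector R.coord_basis_vector)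
          finally show "(\<Sum>s\<in>?X. c p * delta (?v p) s * ?w s) = (if p = (a, b) then c p else 0)" .
        qed
        also have "\<dots> = c (a, b)"
          using ab L.finite_index R.finite_index by simp
        finally show ?thesis by (simp add: ab)
      next
        case False
        have "c \<in> A \<times> B \<rightarrow>\<^sub>E UNIV" using c by simp
        from PiE_arb[OF this False] False show ?thesis by (simp add: eval_def restrict_def)
      qed
    qed
    ultimately show "c \<in> eval ` carrier F" by blast
  qed
qed

lemma tensor_product_coordinates:
  "vs_isomorphic class_ring (tensor_product class_ring V W) (fun_space (A \<times> B))"
  unfolding tensor_product_def
  by (rule quotient_module_vs_isomorphic[OF eval_linear eval_surj span_rels_eq])

end

lemma tensor_product_vs_isomorphic:
  assumes "vs_isomorphic class_ring V (fun_space A)" "vs_isomorphic class_ring W (fun_space B)"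
    and "finite A" "finite B"
  shows "vs_isomorphic class_ring (tensor_product class_ring V W) (fun_space (A \<times> B))"
proof -
  obtain \<phi> where "linear_map class_ring V (fun_space A) \<phi>"
    "bij_betw \<phi> (carrier V) (carrier (fun_space A))"
    using assms(1) unfolding vs_isomorphic_def by (elim exE conjE)
  then interpret L: coordinates V A \<phi>
    unfolding fun_space_simps by (intro coordinates.intro assms(3))
  obtain \<psi> where "linear_map class_ring W (fun_space B) \<psi>"
    "bij_betw \<psi> (carrier W) (carrier (fun_space B))"
    using assms(2) unfolding vs_isomorphic_def by (elim exE conjE)
  then interpret R: coordinates W B \<psi>
    unfolding fun_space_simps by (intro coordinates.intro assms(4))
  interpret tensor_coordinates V A \<phi> W B \<psi> ..
  show ?thesis by (rule tensor_product_coordinates)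
qed

section \<open>Cohomology of interacting tuples\<close>

text \<open>Associativity again, with a vector regarded as a matrix having a single column.\<close>

lemma sum_mmul:
  "(\<Sum>l\<in>S. mmul R M N i l * v l) = (\<Sum>k\<in>R. M i k * (\<Sum>l\<in>S. N k l * v l))"
proof -
  have "mmul S (mmul R M N) (\<lambda>l (_ :: unit). v l) i () = mmul R M (mmul S N (\<lambda>l _. v l)) i ()"
    by (simp add: mmul_assoc)
  then show ?thesis by (simp add: mmul_def)
qed

text \<open>\<open>Q\<close> sends cocycles of degree \<open>p\<close> onto the functions on the
  degree-\<open>p\<close> part of \<open>B\<close>, since \<open>P c\<close> is a cocycle with
  \<open>Q P c = c\<close>. Its kernel consists of the coboundaries: the homotopy equation turns
  \<open>D v = 0\<close> and \<open>Q v = 0\<close> into \<open>v = D (h v)\<close>, and conversely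
  \<open>Q D = 0\<close>.\<close>

lemma interaction_cohomology_vs_isomorphic:
  assumes fin: "finite (cells K)"
    and red: "reduction (interacting K k) (tuple_dim K) (tuple_boundary K) B eg P Q h"
  shows "vs_isomorphic class_ring (interaction_cohomology K k p) (fun_space {b \<in> B. eg b = int p})"
proof -
  interpret R: reduction "interacting K k" "tuple_dim K" "tuple_boundary K" B eg P Q h by fact
  let ?D = "tuple_boundary K" and ?I = "interacting K k"
  let ?T = "\<lambda>q. interacting_tuples K k q"
  define Bp where "Bp = {b \<in> B. eg b = int p}"
  \<comment> \<open>Extension by zero lets the matrices, which cover all degrees at once, act on
    cochains of a single degree.\<close>
  define z where "z q = zero_ext (?T q)" for q
  define D where "D v t = (\<Sum>t'\<in>?I. ?D t t' * v t')" for v :: "'a list \<Rightarrow> real" and t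
  define q where "q v b = (\<Sum>t'\<in>?I. Q b t' * v t')" for v :: "'a list \<Rightarrow> real" and b
  have mem_T: "t \<in> ?T r \<longleftrightarrow> t \<in> ?I \<and> tuple_dim K t = r" for t r
    by (auto simp: interacting_tuples_eq)
  have z_simp: "z r F t = (if t \<in> ?T r then F t else 0)" for r F t
    by (simp add: z_def zero_ext_def)
  \<comment> \<open>Since \<open>D\<close> raises the degree by exactly one, its value on an
    extended cochain is again an extension by zero, namely that of the exterior derivative.\<close>
  have D_z: "D (z r F) t = (if t \<in> ?T (r + 1) then ext_deriv K k r F t else 0)" if "t \<in> ?I" for r F t
  proof (cases "t \<in> ?T (r + 1)")
    case True
    have "D (z r F) t = (\<Sum>t'\<in>?T r. ?D t t' * F t')"
      unfolding D_def
      by (rule sum.mono_neutral_cong_right) (auto simp: mem_T R.finite_index z_simp)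
    then show ?thesis using True ext_deriv_eq[OF fin True] by simp
  next
    case False
    then have "?D t t' * z r F t' = 0" if "t' \<in> ?I" for t'
      using R.D_degree[OF \<open>t \<in> ?I\<close> that] \<open>t \<in> ?I\<close> by (auto simp: z_simp mem_T)
    with False show ?thesis by (simp add: D_def)
  qed
  let ?Z = "{F \<in> ?T (int p) \<rightarrow>\<^sub>E UNIV. \<forall>t\<in>?I. D (z (int p) F) t = 0}"
  have kernel: "a_kernel (cochains K k (int p)) (cochains K k (int p + 1)) (ext_deriv K k (int p)) = ?Z"
  proof -
    have "ext_deriv K k (int p) F = (\<lambda>t\<in>?T (int p + 1). 0) \<longleftrightarrow> (\<forall>t\<in>?I. D (z (int p) F) t = 0)" for F
    proof
      assume "ext_deriv K k (int p) F = (\<lambda>t\<in>?T (int p + 1). 0)"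
      then show "\<forall>t\<in>?I. D (z (int p) F) t = 0" by (simp add: D_z)
    next
      assume *: "\<forall>t\<in>?I. D (z (int p) F) t = 0"
      show "ext_deriv K k (int p) F = (\<lambda>t\<in>?T (int p + 1). 0)"
      proof
        fix t
        show "ext_deriv K k (int p) F t = (\<lambda>t\<in>?T (int p + 1). 0) t"
        proof (cases "t \<in> ?T (int p + 1)")
          case True
          then have "t \<in> ?I" by (simp add: mem_T)
          with * D_z[OF this, of "int p" F] True show ?thesis by simp
        qed (simp add: ext_deriv_def)
      qed
    qed
    then show ?thesis by (simp add: a_kernel_def' cochains_def)
  qed
  define V where "V = (fun_space (?T (int p)))\<lparr>carrier := ?Z\<rparr>"
  have z_add: "z (int p) (\<lambda>t\<in>?T (int p). F t + F' t) = (\<lambda>t. z (int p) F t + z (int p) F' t)" for F F'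
    by (auto simp: z_simp)
  have z_smult: "z (int p) (\<lambda>t\<in>?T (int p). r * F t) = (\<lambda>t. r * z (int p) F t)" for r F
    by (auto simp: z_simp)
  have D_add: "D (\<lambda>t. v t + w t) t = D v t + D w t" for v w t
    by (simp add: D_def distrib_left sum.distrib)
  have D_smult: "D (\<lambda>t. r * v t) t = r * D v t" for r v t
    by (simp add: D_def sum_distrib_left mult.left_commute)
  have q_add: "q (\<lambda>t. v t + w t) t = q v t + q w t" for v w t
    by (simp add: q_def distrib_left sum.distrib)
  have q_smult: "q (\<lambda>t. r * v t) t = r * q v t" for r v t
    by (simp add: q_def sum_distrib_left mult.left_commute)
  have V_space: "vectorspace class_ring V"
    unfolding V_def
  proof (rule fun_space_subspace)
    show "(\<lambda>t\<in>?T (int p). 0) \<in> ?Z"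
      by (simp add: z_simp D_def)
  qed (auto simp: z_add z_smult D_add D_smult)
  define T where "T F = (\<lambda>b\<in>Bp. q (z (int p) F) b)" for F
  have T_linear: "linear_map class_ring V (fun_space Bp) T"
    unfolding linear_map_iff
  proof (intro conjI ballI V_space fun_space_vectorspace)
    show "T \<in> carrier V \<rightarrow> carrier (fun_space Bp)" by (simp add: T_def)
    show "T (F \<oplus>\<^bsub>V\<^esub> F') = T F \<oplus>\<^bsub>fun_space Bp\<^esub> T F'" for F F'
      by (simp add: T_def V_def z_add q_add cong: restrict_cong)
    show "T (r \<odot>\<^bsub>V\<^esub> F) = r \<odot>\<^bsub>fun_space Bp\<^esub> T F" for r F
      by (simp add: T_def V_def z_smult q_smult cong: restrict_cong)
  qed
  have T_surj: "T ` carrier V = carrier (fun_space Bp)"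
  proof
    show "T ` carrier V \<subseteq> carrier (fun_space Bp)"
      using T_linear by (auto simp only: linear_map_iff)
    show "carrier (fun_space Bp) \<subseteq> T ` carrier V"
    proof
      fix c assume "c \<in> carrier (fun_space Bp)"
      then have c: "c \<in> Bp \<rightarrow>\<^sub>E UNIV" by simp
      \<comment> \<open>\<open>c\<close> is extended by 0 to the other degrees, so that
        \<open>P\<close> and \<open>Q\<close> can be summed over all of \<open>B\<close>.\<close>
      define c0 where "c0 b = (if b \<in> Bp then c b else 0)" for b
      define F where "F = (\<lambda>t\<in>?T (int p). \<Sum>b\<in>B. P t b * c0 b)"
      have zF: "z (int p) F t = (\<Sum>b\<in>B. P t b * c0 b)" if "t \<in> ?I" for t
      proof (cases "t \<in> ?T (int p)")
        case False
        then have "P t b * c0 b = 0" if "b \<in> B" for b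
          using R.P_degree[OF \<open>t \<in> ?I\<close> that] \<open>t \<in> ?I\<close> by (cases "P t b = 0") (auto simp: c0_def Bp_def mem_T)
        with False show ?thesis by (simp add: z_simp)
      qed (simp add: z_simp F_def)
      have "D (z (int p) F) t = 0" if "t \<in> ?I" for t
      proof -
        have "D (z (int p) F) t = (\<Sum>b\<in>B. mmul ?I ?D P t b * c0 b)"
          by (simp add: D_def zF sum_mmul)
        then show ?thesis using that by (simp add: R.DP)
      qed
      then have "F \<in> carrier V" by (simp add: V_def F_def)
      moreover have "T F = c"
      proof
        fix b
        show "T F b = c b"
        proof (cases "b \<in> Bp")
          case True
          then have b: "b \<in> B" by (simp add: Bp_def)
          have "q (z (int p) F) b = (\<Sum>b'\<in>B. mmul ?I Q P b b' * c0 b')"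
            by (simp add: q_def zF sum_mmul)
          also have "\<dots> = (\<Sum>b'\<in>B. if b' = b then c0 b' else 0)"
            by (rule sum.cong) (auto simp: R.QP b)
          also have "\<dots> = c b"
            using b R.finite_reduced True by (simp add: c0_def)
          finally show ?thesis using True by (simp add: T_def)
        next
          case False
          then show ?thesis using PiE_arb[OF c False] by (simp add: T_def)
        qed
      qed
      ultimately show "c \<in> T ` carrier V" by blast
    qed
  qed
  let ?im = "ext_deriv K k (int p - 1) ` carrier (cochains K k (int p - 1))"
  have im: "?im = {F \<in> carrier V. T F = \<zero>\<^bsub>fun_space Bp\<^esub>}"
  proof (intro equalityI subsetI)
    fix F assume "F \<in> ?im"
    then obtain g where F: "F = ext_deriv K k (int p - 1) g" by blast
    have zF: "z (int p) F t = D (z (int p - 1) g) t" if "t \<in> ?I" for t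
      using D_z[OF that, of "int p - 1" g] by (simp add: z_simp F)
    have "D (z (int p) F) t = 0" if "t \<in> ?I" for t
    proof -
      have "D (z (int p) F) t = (\<Sum>t'\<in>?I. mmul ?I ?D ?D t t' * z (int p - 1) g t')"
        by (simp add: D_def[of "z (int p) F"] zF sum_mmul) (simp add: D_def)
      then show ?thesis using that by (simp add: R.D_square)
    qed
    moreover have "q (z (int p) F) b = 0" if "b \<in> B" for b
    proof -
      have "q (z (int p) F) b = (\<Sum>t'\<in>?I. mmul ?I Q ?D b t' * z (int p - 1) g t')"
        by (simp add: q_def zF sum_mmul) (simp add: D_def)
      then show ?thesis using that by (simp add: R.QD)
    qed
    moreover have "F \<in> ?T (int p) \<rightarrow>\<^sub>E UNIV"
      by (simp add: F ext_deriv_def)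
    ultimately show "F \<in> {F \<in> carrier V. T F = \<zero>\<^bsub>fun_space Bp\<^esub>}"
      by (auto simp: V_def T_def Bp_def)
  next
    fix F assume "F \<in> {F \<in> carrier V. T F = \<zero>\<^bsub>fun_space Bp\<^esub>}"
    then have F: "F \<in> ?T (int p) \<rightarrow>\<^sub>E UNIV" "\<And>t. t \<in> ?I \<Longrightarrow> D (z (int p) F) t = 0"
      and TF: "T F = (\<lambda>b\<in>Bp. 0)"
      by (simp_all add: V_def)
    \<comment> \<open>The hypothesis covers only generators of degree \<open>p\<close>; for the
      others the value is 0 because \<open>Q\<close> preserves degrees.\<close>
    have qF: "q (z (int p) F) b = 0" if "b \<in> B" for b
    proof (cases "b \<in> Bp")
      case True
      then show ?thesis using fun_cong[OF TF, of b] by (simp add: T_def)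
    next
      case False
      then have "Q b t * z (int p) F t = 0" if "t \<in> ?I" for t
        using R.Q_degree[OF that \<open>b \<in> B\<close>] \<open>b \<in> B\<close> by (cases "Q b t = 0") (auto simp: z_simp mem_T Bp_def)
      then show ?thesis by (simp add: q_def)
    qed
    \<comment> \<open>The primitive supplied by the homotopy, \<open>h\<close> applied to the
      cocycle.\<close>
    define g where "g = (\<lambda>t\<in>?T (int p - 1). \<Sum>t'\<in>?I. h t t' * z (int p) F t')"
    have zg: "z (int p - 1) g t = (\<Sum>t'\<in>?I. h t t' * z (int p) F t')" if "t \<in> ?I" for t
    proof (cases "t \<in> ?T (int p - 1)")
      case False
      then have "h t t' * z (int p) F t' = 0" if "t' \<in> ?I" for t'
        using R.h_degree[OF \<open>t \<in> ?I\<close> that] \<open>t \<in> ?I\<close>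
        by (cases "h t t' = 0") (auto simp: z_simp mem_T)
      with False show ?thesis by (simp add: z_simp)
    qed (simp add: z_simp g_def)
    have zF: "z (int p) F t = D (z (int p - 1) g) t" if t: "t \<in> ?I" for t
    proof -
      let ?v = "z (int p) F"
      have "?v t = (\<Sum>t'\<in>?I. of_bool (t = t') * ?v t')"
        using R.finite_index t by (simp add: of_bool_def if_distrib[of "\<lambda>x. x * _"] cong: if_cong)
      also have "\<dots> = (\<Sum>t'\<in>?I. (mmul B P Q t t' + (mmul ?I ?D h t t' + mmul ?I h ?D t t')) * ?v t')"
        by (rule sum.cong[OF refl]) (use R.homotopy[OF t] in \<open>simp add: algebra_simps\<close>)
      also have "\<dots> = (\<Sum>b\<in>B. P t b * q ?v b) + ((\<Sum>t'\<in>?I. ?D t t' * (\<Sum>l\<in>?I. h t' l * ?v l))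
          + (\<Sum>t'\<in>?I. h t t' * D ?v t'))"
        by (simp add: distrib_right sum.distrib sum_mmul) (simp add: q_def D_def)
      also have "\<dots> = D (z (int p - 1) g) t"
        by (simp add: qF F(2) zg D_def[of "z (int p - 1) g"])
      finally show ?thesis .
    qed
    have "F = ext_deriv K k (int p - 1) g"
    proof
      fix t
      show "F t = ext_deriv K k (int p - 1) g t"
      proof (cases "t \<in> ?T (int p)")
        case True
        then have "t \<in> ?I" by (simp add: mem_T)
        then show ?thesis
          using zF[of t] D_z[of t "int p - 1" g] True by (simp add: z_simp)
      next
        case False
        then show ?thesis using PiE_arb[OF F(1) False] by (simp add: ext_deriv_def)
      qed
    qed
    moreover have "g \<in> carrier (cochains K k (int p - 1))"
      by (simp add: cochains_def g_def)
    ultimately show "F \<in> ?im" by blast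
  qed
  have "interaction_cohomology K k p = quotient_module V ?im"
    by (simp add: interaction_cohomology_def kernel) (simp add: V_def cochains_def)
  then show ?thesis
    using quotient_module_vs_isomorphic[OF T_linear T_surj im] by (simp add: Bp_def)
qed

lemma tuple_dim_nonneg: "0 \<le> tuple_dim K t"
  by (induction t) simp_all

theorem mainTheorem8:
  fixes G :: "'a set set" and H :: "'b set set"
    and oriG :: "'a set \<Rightarrow> 'a list" and oriH :: "'b set \<Rightarrow> 'b list"
    and k p :: nat
  assumes "simplicial_complex G" and "orientation G oriG"
    and "simplicial_complex H" and "orientation H oriH"
    and "k \<ge> 1"
  shows "vs_isomorphic class_ring
    (interaction_cohomology
      (product_cells (simplicial_cells G oriG) (simplicial_cells H oriH)) k p)
    (direct_sum_family {(i, j). i + j = p}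
      (\<lambda>(i, j). tensor_product class_ring
         (interaction_cohomology (simplicial_cells G oriG) k i)
         (interaction_cohomology (simplicial_cells H oriH) k j)))"
proof -
  let ?K = "simplicial_cells G oriG" and ?L = "simplicial_cells H oriH"
  have K: "regular_cells ?K" and L: "regular_cells ?L"
    using assms by (auto intro!: oriented_complex.regular_simplicial_cells oriented_complex.intro)
  have fin: "finite (cells ?K)" "finite (cells ?L)"
    using K L by (simp_all add: regular_cells_def)
  obtain B P Q h where
    red: "reduction (interacting ?K k) (tuple_dim ?K) (tuple_boundary ?K) B (tuple_dim ?K) P Q h"
    using reduction_exists[OF interacting_complex[OF K, of k]] by blast
  obtain B' P' Q' h' where
    red': "reduction (interacting ?L k) (tuple_dim ?L) (tuple_boundary ?L) B' (tuple_dim ?L) P' Q' h'"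
    using reduction_exists[OF interacting_complex[OF L, of k]] by blast
  obtain P2 Q2 h2 where red2: "reduction (interacting (product_cells ?K ?L) k)
      (tuple_dim (product_cells ?K ?L)) (tuple_boundary (product_cells ?K ?L))
      (B \<times> B') (\<lambda>b. tuple_dim ?K (fst b) + tuple_dim ?L (snd b)) P2 Q2 h2"
    using product_reduction_exists[OF K L red red'] by blast
  have finB: "finite B" "finite B'"
    by (rule reduction.finite_reduced[OF red], rule reduction.finite_reduced[OF red'])
  \<comment> \<open>The degree-\<open>p\<close> part of the tensor basis; both sides are compared
    with the functions on it.\<close>
  let ?C = "{b \<in> B \<times> B'. tuple_dim ?K (fst b) + tuple_dim ?L (snd b) = int p}"
  have "vs_isomorphic class_ring (direct_sum_family {(i, j). i + j = p}
      (\<lambda>(i, j). tensor_product class_ring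
         (interaction_cohomology ?K k i) (interaction_cohomology ?L k j))) (fun_space ?C)"
  \<comment> \<open>The blocks are indexed by the pair of component degrees. These are integers but
    nonnegative, so converting them to naturals loses nothing.\<close>
  proof (rule direct_sum_family_vs_isomorphic[where
        C = "\<lambda>(i, j). {b \<in> B. tuple_dim ?K b = int i} \<times> {b \<in> B'. tuple_dim ?L b = int j}" and
        ind = "\<lambda>b. (nat (tuple_dim ?K (fst b)), nat (tuple_dim ?L (snd b)))"])
    have "{(i, j). i + j = p} \<subseteq> {..p} \<times> {..p}" by auto
    then show "finite {(i, j). i + j = p}" by (rule finite_subset) simp
  next
    fix ij assume "ij \<in> {(i, j). i + j = p}"
    obtain i j where ij: "ij = (i, j)" by (cases ij)
    show "vs_isomorphic class_ring (case ij of (i, j) \<Rightarrow> tensor_product class_ring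
         (interaction_cohomology ?K k i) (interaction_cohomology ?L k j))
       (fun_space (case ij of (i, j) \<Rightarrow>
         {b \<in> B. tuple_dim ?K b = int i} \<times> {b \<in> B'. tuple_dim ?L b = int j}))"
      unfolding ij prod.case
      by (intro tensor_product_vs_isomorphic interaction_cohomology_vs_isomorphic[OF fin(1) red]
          interaction_cohomology_vs_isomorphic[OF fin(2) red']) (simp_all add: finB)
  next
    fix ij b assume "ij \<in> {(i, j). i + j = p}"
    then show "b \<in> (case ij of (i, j) \<Rightarrow>
         {b \<in> B. tuple_dim ?K b = int i} \<times> {b \<in> B'. tuple_dim ?L b = int j}) \<longleftrightarrow>
      b \<in> ?C \<and> (nat (tuple_dim ?K (fst b)), nat (tuple_dim ?L (snd b))) = ij"
      using tuple_dim_nonneg[of ?K "fst b"] tuple_dim_nonneg[of ?L "snd b"]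
      by (cases ij; cases b) auto
  next
    fix b assume "b \<in> ?C"
    then show "(nat (tuple_dim ?K (fst b)), nat (tuple_dim ?L (snd b))) \<in> {(i, j). i + j = p}"
      using tuple_dim_nonneg[of ?K "fst b"] tuple_dim_nonneg[of ?L "snd b"]
      by (simp add: nat_add_distrib[symmetric])
  qed
  moreover have "vs_isomorphic class_ring (interaction_cohomology (product_cells ?K ?L) k p)
      (fun_space ?C)"
    by (rule interaction_cohomology_vs_isomorphic[OF _ red2]) (simp add: fin)
  ultimately show ?thesis
    using vs_isomorphic_trans vs_isomorphic_sym by blast
qed

end
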